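(* Let $E_2\subset\{0,1\}^\omega$ be the set of $\xi$ such that the orbital Schreier graph $\Gamma_\xi$ of the Basilica group has exactly two ends. The two-ended orbital Schreier graphs $\Gamma_\xi$, $\xi\in E_2$, form an uncountable family of non-isomorphic graphs (i.e. they represent uncountably many isomorphism classes of unrooted graphs) which are not quasi-isometric to the one-dimensional lattice $\mathbb{Z}$.
   Context: The Basilica group $\mathcal{B}$ is the group of automorphisms of the binary rooted tree (vertices = finite words over $\{0,1\}$) generated by $a,b$ defined recursively by $a(0w)=0\,b(w)$, $a(1w)=1w$, $b(0w)=1\,a(w)$, $b(1w)=0w$; these formulas also define its action on the set $\{0,1\}^\omega$ of infinite words. For $\xi\in\{0,1\}^\omega$, the orbital Schreier graph $\Gamma_\xi$ is the graph with vertex set the orbit $\mathcal{B}\cdot\xi$ and, for each vertex $\eta$ and each $s\in\{a,b\}$, one (unoriented, unlabeled) edge between $\eta$ and $s(\eta)$ (loops and multiple edges allowed). *)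

theory Defs
  imports
    Complex_Main
    "HOL-Library.Stream"
    "HOL-Library.Countable_Set"
    "HOL-Algebra.Group_Action"
    "HOL-Algebra.Generated_Groups"
begin

section \<open>Unoriented multigraphs\<close>

text \<open>An edge is an abstract object with a set of endpoints (one endpoint for a loop), so loops
  and multiple edges are allowed.\<close>

record ('v, 'e) multigraph =
  verts :: "'v set"
  edges :: "'e set"
  endpts :: "'e \<Rightarrow> 'v set"

definition graph_iso :: "('v, 'e) multigraph \<Rightarrow> ('w, 'f) multigraph \<Rightarrow> bool" where
  "graph_iso G H \<longleftrightarrow>
     (\<exists>f g. bij_betw f (verts G) (verts H) \<and> bij_betw g (edges G) (edges H) \<and>
            (\<forall>e\<in>edges G. endpts H (g e) = f ` endpts G e))"

definition adj_rel :: "('v, 'e) multigraph \<Rightarrow> 'v rel" where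
  "adj_rel G = {(u, v). \<exists>e\<in>edges G. endpts G e = {u, v}}"

text \<open>The path metric. It is meaningful only for vertices in the same connected component, and
  is used below only for connected graphs.\<close>

definition graph_dist :: "('v, 'e) multigraph \<Rightarrow> 'v \<Rightarrow> 'v \<Rightarrow> nat" where
  "graph_dist G u v = (LEAST n. (u, v) \<in> adj_rel G ^^ n)"


section \<open>Ends\<close>

definition ray :: "('v, 'e) multigraph \<Rightarrow> (nat \<Rightarrow> 'v) \<Rightarrow> bool" where
  "ray G r \<longleftrightarrow> inj r \<and> range r \<subseteq> verts G \<and> (\<forall>n. (r n, r (Suc n)) \<in> adj_rel G)"

text \<open>Two rays are equivalent if, whenever a finite set of vertices is removed, they have tails
  in the same connected component of the remaining graph.\<close>

definition ray_equiv :: "('v, 'e) multigraph \<Rightarrow> (nat \<Rightarrow> 'v) rel" where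
  "ray_equiv G = {(r, r'). ray G r \<and> ray G r' \<and>
     (\<forall>S. finite S \<longrightarrow>
       (\<exists>N. \<forall>m\<ge>N. \<forall>n\<ge>N. (r m, r' n) \<in> (Restr (adj_rel G) (verts G - S))\<^sup>*))}"

definition graph_ends :: "('v, 'e) multigraph \<Rightarrow> (nat \<Rightarrow> 'v) set set" where
  "graph_ends G = {r. ray G r} // ray_equiv G"


section \<open>Quasi-isometry\<close>

definition quasi_isometry ::
  "'v set \<Rightarrow> ('v \<Rightarrow> 'v \<Rightarrow> real) \<Rightarrow> 'w set \<Rightarrow> ('w \<Rightarrow> 'w \<Rightarrow> real) \<Rightarrow> ('v \<Rightarrow> 'w) \<Rightarrow> bool" where
  "quasi_isometry X dX Y dY f \<longleftrightarrow>
     f \<in> X \<rightarrow> Y \<and>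
     (\<exists>C\<ge>1. \<exists>D\<ge>0.
        (\<forall>x\<in>X. \<forall>x'\<in>X. dX x x' / C - D \<le> dY (f x) (f x') \<and>
                        dY (f x) (f x') \<le> C * dX x x' + D) \<and>
        (\<forall>y\<in>Y. \<exists>x\<in>X. dY (f x) y \<le> D))"

definition quasi_isometric_graphs :: "('v, 'e) multigraph \<Rightarrow> ('w, 'f) multigraph \<Rightarrow> bool" where
  "quasi_isometric_graphs G H \<longleftrightarrow>
     (\<exists>f. quasi_isometry (verts G) (\<lambda>x y. real (graph_dist G x y))
                         (verts H) (\<lambda>x y. real (graph_dist H x y)) f)"

definition int_lattice :: "(int, int) multigraph" where
  "int_lattice = \<lparr>verts = UNIV, edges = UNIV, endpts = (\<lambda>i. {i, i + 1})\<rparr>"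


section \<open>The Basilica group\<close>

text \<open>The letters 0 and 1 are encoded as \<^const>\<open>False\<close> and \<^const>\<open>True\<close>.\<close>

datatype basilica_gen = is_a: Gen_a | is_b: Gen_b

primcorec gen_act :: "basilica_gen \<Rightarrow> bool stream \<Rightarrow> bool stream" where
  "gen_act s w =
     (case s of
        Gen_a \<Rightarrow> if shd w then True ## stl w else False ## gen_act Gen_b (stl w)
      | Gen_b \<Rightarrow> if shd w then False ## stl w else True ## gen_act Gen_a (stl w))"

lemma gen_act_simps [simp]:
  "gen_act Gen_a (False ## w) = False ## gen_act Gen_b w"
  "gen_act Gen_a (True ## w) = True ## w"
  "gen_act Gen_b (False ## w) = True ## gen_act Gen_a w"
  "gen_act Gen_b (True ## w) = False ## w"
  by (subst gen_act.code, simp)+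

primcorec gen_inv :: "basilica_gen \<Rightarrow> bool stream \<Rightarrow> bool stream" where
  "gen_inv s w =
     (case s of
        Gen_a \<Rightarrow> if shd w then True ## stl w else False ## gen_inv Gen_b (stl w)
      | Gen_b \<Rightarrow> if shd w then False ## gen_inv Gen_a (stl w) else True ## stl w)"

lemma gen_inv_gen_act: "gen_inv s (gen_act s w) = w"
  by (coinduction arbitrary: s w rule: stream.coinduct_strong) (auto split: basilica_gen.splits)

lemma gen_act_gen_inv: "gen_act s (gen_inv s w) = w"
  by (coinduction arbitrary: s w rule: stream.coinduct_strong) (auto split: basilica_gen.splits)

lemma bij_gen_act: "bij (gen_act s)"
  by (metis bijI' gen_act_gen_inv gen_inv_gen_act)

definition basilica_group :: "(bool stream \<Rightarrow> bool stream) monoid" where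
  "basilica_group = subgroup_generated (BijGroup UNIV) {gen_act Gen_a, gen_act Gen_b}"

text \<open>Since \<^const>\<open>subgroup_generated\<close> discards generators outside the carrier, we record that
  both generators survive.\<close>

lemma gen_act_in_basilica_group: "gen_act s \<in> carrier basilica_group"
proof -
  have "gen_act s \<in> carrier (BijGroup UNIV)"
    using bij_gen_act by (simp add: BijGroup_def Bij_def)
  moreover have "gen_act s \<in> {gen_act Gen_a, gen_act Gen_b}"
    by (cases s) auto
  ultimately show ?thesis
    unfolding basilica_group_def carrier_subgroup_generated by (blast intro: generate.incl)
qed


section \<open>Orbital Schreier graphs\<close>

definition schreier_graph :: "bool stream \<Rightarrow> (bool stream, bool stream \<times> basilica_gen) multigraph"
  where
  "schreier_graph \<xi> =
     \<lparr>verts = orbit basilica_group (\<lambda>g. g) \<xi>,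
      edges = orbit basilica_group (\<lambda>g. g) \<xi> \<times> UNIV,
      endpts = (\<lambda>(\<eta>, s). {\<eta>, gen_act s \<eta>})\<rparr>"

definition E2 :: "bool stream set" where
  "E2 = {\<xi>. card (graph_ends (schreier_graph \<xi>)) = 2}"

end

theory Submission
  imports Defs
begin

text \<open>
  The orbital Schreier graphs of the Basilica group are not quasi-isometric to the integers because they
  grow at least quadratically. The squares of \<open>a\<close> and \<open>b\<close> act on words \<open>00w\<close> as
  \<open>a\<close> and \<open>b\<close> act on \<open>w\<close>, so two words that differ only in their first \<open>2k\<close> letters are joined by a path
  of length less than \<open>4 * 2^k\<close> (\<open>near_prefix\<close>). A ball of that radius therefore contains \<open>4^k\<close> vertices,
  whereas a graph of bounded degree that is quasi-isometric to the integers grows linearly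
  (\<open>schreier_not_quasi_isometric_int\<close>).

  For the uncountability it suffices to have an uncountable set of words with two-ended graphs among which every
  isomorphism class is countable. Take the words \<open>x0x0x0...\<close>, in which every second letter is 0, outside the
  orbit of \<open>0^\<omega>\<close>. On them \<open>b\<close> acts as a binary odometer on the remaining digits, so that the \<open>b\<close>-edges
  form a bi-infinite line. An explicit retraction onto this line is constant along all
  other edges (\<open>proj_gen_act\<close>), and its fibres are finite, so the graph is a line to which finite pieces
  are attached at single vertices (\<open>schreier_decorated_line\<close>). Such a graph has exactly two ends: a ray
  must run to infinity along the line in one of the two directions (\<open>decorated_line.two_ended\<close>).

  A line with finite decorations is rigid. Its vertices on the line are exactly those whose removal leaves two
  separated infinite parts, so an isomorphism induces a translation or a reflection of the line and
  preserves the sizes of the decorations (\<open>iso_decorated_lines\<close>). In the Basilica graphs the size of the decoration at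
  \<open>10w\<close> is 1 and that at \<open>00w\<close> is \<open>4n - 1\<close> for \<open>n\<close> the size at \<open>w\<close> (\<open>card_fibre_False\<close>); so the sizes along the
  line, read from a given origin, determine the word at the origin (\<open>fibre_cards_determine\<close>). As there are
  countably many translations and reflections of the integers, only countably many words of the family give a graph
  isomorphic to a given one (\<open>countable_iso_class\<close>).
\<close>

section \<open>Orbits as classes of elementary moves\<close>

text \<open>Reading the orbits as the classes of the relation generated by single moves of \<open>a\<close> and \<open>b\<close>
  removes the group from all later arguments.\<close>

definition step :: "bool stream rel" where
  "step = {(u, v). \<exists>s. v = gen_act s u \<or> u = gen_act s v}"

lemma step_gen_act: "(u, gen_act s u) \<in> step"
  by (auto simp: step_def)

lemma step_gen_inv: "(u, gen_inv s u) \<in> step"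
  using gen_act_gen_inv[of s u] by (auto simp: step_def intro!: exI[of _ s])

lemma sym_step: "sym step"
  by (auto simp: step_def sym_def)

lemma step_image: "step `` {u} = (\<lambda>s. gen_act s u) ` UNIV \<union> (\<lambda>s. gen_inv s u) ` UNIV"
proof (rule Set.set_eqI)
  fix v
  have "u = gen_act s v \<longleftrightarrow> v = gen_inv s u" for s
    by (metis gen_inv_gen_act gen_act_gen_inv)
  then show "v \<in> step `` {u} \<longleftrightarrow> v \<in> (\<lambda>s. gen_act s u) ` UNIV \<union> (\<lambda>s. gen_inv s u) ` UNIV"
    by (auto simp: step_def)
qed

lemma UNIV_gen: "(UNIV :: basilica_gen set) = {Gen_a, Gen_b}"
  using basilica_gen.exhaust by auto

lemma step_rtrancl_sym: "(u, v) \<in> step\<^sup>* \<Longrightarrow> (v, u) \<in> step\<^sup>*"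
  using sym_rtrancl[OF sym_step] by (auto simp: sym_def)

text \<open>An element of the group is a product of generators and their inverses, so it moves a word along
  finitely many steps; conversely the orbit is closed under each step.\<close>

lemma orbit_eq_step_class: "orbit basilica_group (\<lambda>g. g) \<xi> = step\<^sup>* `` {\<xi>}"
proof (intro equalityI subsetI)
  fix u assume "u \<in> orbit basilica_group (\<lambda>g. g) \<xi>"
  then obtain g where g: "g \<in> carrier basilica_group" and u: "u = g \<xi>"
    by (auto simp: orbit_def)
  have G: "group (BijGroup (UNIV :: bool stream set))" by (rule group_BijGroup)
  from g have "g \<in> generate (BijGroup UNIV) (carrier (BijGroup UNIV) \<inter> {gen_act Gen_a, gen_act Gen_b})"
    by (simp add: basilica_group_def carrier_subgroup_generated)
  then have "g \<in> carrier (BijGroup UNIV) \<and> (\<forall>v. (v, g v) \<in> step\<^sup>*)"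
  proof induction
    case one
    then show ?case by (auto simp: BijGroup_def Bij_def bij_betw_def)
  next
    case (incl h)
    then show ?case using step_gen_act by auto
  next
    case (inv h)
    then obtain s where h: "h = gen_act s" "h \<in> Bij UNIV" by (auto simp: BijGroup_def)
    have "inv\<^bsub>BijGroup UNIV\<^esub> h = gen_inv s"
    proof -
      have "inv_into UNIV (gen_act s) x = gen_inv s x" for x
        by (metis bij_gen_act bij_inv_eq_iff gen_act_gen_inv)
      then show ?thesis using h by (auto simp: inv_BijGroup)
    qed
    moreover have "inv\<^bsub>BijGroup UNIV\<^esub> h \<in> carrier (BijGroup UNIV)"
      using group.inv_closed[OF G] inv by auto
    ultimately show ?case using step_gen_inv by auto
  next
    case (eng h1 h2)
    have "h1 \<otimes>\<^bsub>BijGroup UNIV\<^esub> h2 = h1 \<circ> h2"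
      using eng by (auto simp: BijGroup_def compose_def)
    moreover have "h1 \<otimes>\<^bsub>BijGroup UNIV\<^esub> h2 \<in> carrier (BijGroup UNIV)"
      using group.is_monoid[OF G] eng by (simp add: monoid.m_closed)
    moreover have "(v, h1 (h2 v)) \<in> step\<^sup>*" for v
      using eng by (blast intro: rtrancl_trans)
    ultimately show ?case by (metis comp_apply)
  qed
  then show "u \<in> step\<^sup>* `` {\<xi>}" using u by auto
next
  fix u assume "u \<in> step\<^sup>* `` {\<xi>}"
  then have "(\<xi>, u) \<in> step\<^sup>*" by simp
  moreover have "group (BijGroup (UNIV :: bool stream set))" by (rule group_BijGroup)
  then have B: "group basilica_group"
    unfolding basilica_group_def by (rule group.group_subgroup_generated)
  have carr: "g \<in> Bij UNIV" if "g \<in> carrier basilica_group" for g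
    using that group.carrier_subgroup_generated_subset[OF group_BijGroup] 
    unfolding basilica_group_def by (auto simp: BijGroup_def)
  have inv_gen: "(inv\<^bsub>basilica_group\<^esub> (gen_act s)) v = gen_inv s v" for s v
  proof -
    have "gen_act s \<otimes>\<^bsub>basilica_group\<^esub> inv\<^bsub>basilica_group\<^esub> (gen_act s) = \<one>\<^bsub>basilica_group\<^esub>"
      by (rule group.r_inv[OF B gen_act_in_basilica_group])
    then have "compose UNIV (gen_act s) (inv\<^bsub>basilica_group\<^esub> (gen_act s)) = (\<lambda>x. x)"
      using carr[OF gen_act_in_basilica_group] carr[OF group.inv_closed[OF B gen_act_in_basilica_group]]
      by (auto simp: basilica_group_def subgroup_generated_def BijGroup_def restrict_def)
    then have "gen_act s ((inv\<^bsub>basilica_group\<^esub> (gen_act s)) v) = v"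
      by (metis UNIV_I compose_eq)
    then show ?thesis by (metis gen_inv_gen_act)
  qed
  have mult: "(g \<otimes>\<^bsub>basilica_group\<^esub> h) v = g (h v)"
    if "g \<in> carrier basilica_group" "h \<in> carrier basilica_group" for g h v
    using carr[OF that(1)] carr[OF that(2)]
    by (simp add: basilica_group_def subgroup_generated_def BijGroup_def compose_def)
  have closed: "g (h \<xi>) \<in> orbit basilica_group (\<lambda>g. g) \<xi>"
    if "g \<in> carrier basilica_group" "h \<in> carrier basilica_group" for g h
  proof -
    have "g \<otimes>\<^bsub>basilica_group\<^esub> h \<in> carrier basilica_group"
      using monoid.m_closed[OF group.is_monoid[OF B] that] .
    then show ?thesis unfolding orbit_def using mult[OF that, of \<xi>, symmetric] by blast
  qed
  from \<open>(\<xi>, u) \<in> step\<^sup>*\<close> show "u \<in> orbit basilica_group (\<lambda>g. g) \<xi>"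
  proof induction
    case base
    have "\<one>\<^bsub>basilica_group\<^esub> \<in> carrier basilica_group"
      using group.is_monoid[OF B] by (rule monoid.one_closed)
    moreover have "\<one>\<^bsub>basilica_group\<^esub> \<xi> = \<xi>"
      by (simp add: basilica_group_def subgroup_generated_def BijGroup_def)
    ultimately show ?case unfolding orbit_def by (metis (mono_tags, lifting) mem_Collect_eq)
  next
    case (step u v)
    then obtain h where h: "h \<in> carrier basilica_group" "u = h \<xi>" by (auto simp: orbit_def)
    from step(2) obtain s where "v = gen_act s u \<or> v = gen_inv s u"
      using step_image[of u] by auto
    then show ?case
    proof
      assume "v = gen_act s u"
      then show ?thesis using closed[OF gen_act_in_basilica_group h(1)] h(2) by simp
    next
      assume "v = gen_inv s u"
      then show ?thesis
        using closed[OF group.inv_closed[OF B gen_act_in_basilica_group] h(1)] h(2)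
        by (simp add: inv_gen)
    qed
  qed
qed

lemma verts_schreier: "verts (schreier_graph \<xi>) = step\<^sup>* `` {\<xi>}"
  by (simp add: schreier_graph_def orbit_eq_step_class)

lemma adj_schreier: "adj_rel (schreier_graph \<xi>) = Restr step (step\<^sup>* `` {\<xi>})"
proof -
  let ?V = "step\<^sup>* `` {\<xi>}"
  have "adj_rel (schreier_graph \<xi>) = {(u, v). \<exists>\<eta>\<in>?V. \<exists>s. {\<eta>, gen_act s \<eta>} = {u, v}}"
    by (auto simp: adj_rel_def schreier_graph_def orbit_eq_step_class)
  also have "\<dots> = Restr step ?V"
    using rtrancl_into_rtrancl[OF _ step_gen_act]
    by (auto simp: step_def doubleton_eq_iff) 
  finally show ?thesis .
qed

lemma schreier_wf: "e \<in> edges (schreier_graph \<xi>) \<Longrightarrow> endpts (schreier_graph \<xi>) e \<subseteq> verts (schreier_graph \<xi>)"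
  using rtrancl_into_rtrancl[OF _ step_gen_act]
  by (auto simp: schreier_graph_def orbit_eq_step_class)

text \<open>A walk of steps that starts in an orbit never leaves it, so path lengths may be computed in
  the ambient relation, without mentioning the base point.\<close>

lemma relpow_adj_schreier:
  assumes "u \<in> verts (schreier_graph \<xi>)"
  shows "(u, v) \<in> adj_rel (schreier_graph \<xi>) ^^ n \<longleftrightarrow> (u, v) \<in> step ^^ n"
  using assms
proof (induction n arbitrary: v)
  case (Suc n)
  show ?case
  proof
    assume "(u, v) \<in> adj_rel (schreier_graph \<xi>) ^^ Suc n"
    then show "(u, v) \<in> step ^^ Suc n" using Suc by (auto simp: adj_schreier)
  next
    assume "(u, v) \<in> step ^^ Suc n"
    then obtain w where w: "(u, w) \<in> step ^^ n" "(w, v) \<in> step" by auto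
    then have "w \<in> step\<^sup>* `` {\<xi>}" "v \<in> step\<^sup>* `` {\<xi>}"
      using Suc.prems unfolding verts_schreier
      by (auto dest: relpow_imp_rtrancl intro: rtrancl_trans rtrancl_into_rtrancl)
    then have "(w, v) \<in> adj_rel (schreier_graph \<xi>)" using w by (simp add: adj_schreier)
    then show "(u, v) \<in> adj_rel (schreier_graph \<xi>) ^^ Suc n" using Suc w by auto
  qed
qed simp

lemma schreier_connected:
  assumes "u \<in> verts (schreier_graph \<xi>)" "v \<in> verts (schreier_graph \<xi>)"
  shows "(u, v) \<in> (adj_rel (schreier_graph \<xi>))\<^sup>*"
proof -
  have "(u, v) \<in> step\<^sup>*"
    using assms unfolding verts_schreier by (auto intro: rtrancl_trans step_rtrancl_sym)
  then show ?thesis using relpow_adj_schreier[OF assms(1)] by (auto simp: rtrancl_is_UN_relpow)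
qed

section \<open>Quadratic growth\<close>

definition near :: "nat \<Rightarrow> bool stream \<Rightarrow> bool stream \<Rightarrow> bool" where
  "near n u v \<longleftrightarrow> (\<exists>m\<le>n. (u, v) \<in> step ^^ m)"

lemma near_refl: "near n u u"
  unfolding near_def by (intro exI[of _ 0]) auto

lemma near_step: "(u, v) \<in> step \<Longrightarrow> near 1 u v"
  unfolding near_def by (intro exI[of _ 1]) auto

lemma near_trans: "near m u v \<Longrightarrow> near n v w \<Longrightarrow> near (m + n) u w"
  unfolding near_def by (meson add_mono relpow_trans)

lemma near_sym: "near n u v \<Longrightarrow> near n v u"
proof -
  have "(u, v) \<in> step ^^ m \<Longrightarrow> (v, u) \<in> step ^^ m" for m
  proof (induction m arbitrary: v)
    case (Suc m)
    then obtain w where "(w, u) \<in> step ^^ m" "(v, w) \<in> step"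
      using symD[OF sym_step] by auto
    then show ?case by (rule relpow_Suc_I2[rotated])
  qed simp
  then show "near n u v \<Longrightarrow> near n v u" unfolding near_def by blast
qed

lemma near_mono: "near m u v \<Longrightarrow> m \<le> n \<Longrightarrow> near n u v"
  unfolding near_def by (meson order_trans)

lemma near_imp_rtrancl: "near n u v \<Longrightarrow> (u, v) \<in> step\<^sup>*"
  unfolding near_def by (meson relpow_imp_rtrancl)

lemma near_0: "near 0 u v \<longleftrightarrow> u = v" by (auto simp: near_def)

lemma near_Suc: "near (Suc n) u w \<longleftrightarrow> u = w \<or> (\<exists>v. near n u v \<and> (v, w) \<in> step)"
proof
  assume "near (Suc n) u w"
  then obtain m where m: "m \<le> Suc n" "(u, w) \<in> step ^^ m" by (auto simp: near_def)
  show "u = w \<or> (\<exists>v. near n u v \<and> (v, w) \<in> step)"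
  proof (cases m)
    case 0
    then show ?thesis using m by auto
  next
    case (Suc k)
    then show ?thesis using m unfolding near_def by auto
  qed
next
  assume "u = w \<or> (\<exists>v. near n u v \<and> (v, w) \<in> step)"
  then show "near (Suc n) u w"
    using near_refl near_trans near_step by (metis Suc_eq_plus1)
qed

text \<open>The self-similarity behind the growth estimate. On words \<open>00w\<close> the squares act by
  \<open>a(a(00w)) = 00a(w)\<close> and \<open>b(b(00w)) = 00b(w)\<close>, so a step between tails is copied at the
  price of doubling its length.\<close>

lemma step_lift:
  assumes "(u, v) \<in> step"
  shows "near 2 (False ## False ## u) (False ## False ## v)"
proof -
  have fwd: "near 2 (False ## False ## w) (False ## False ## gen_act s w)" for s w
  proof (cases s)
    case Gen_a
    have "gen_act Gen_a (gen_act Gen_a (False ## False ## w)) = False ## False ## gen_act Gen_a w" by simp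
    then show ?thesis
      using Gen_a near_trans[OF near_step[OF step_gen_act] near_step[OF step_gen_act]] by (metis one_add_one)
  next
    case Gen_b
    have "gen_act Gen_b (gen_act Gen_b (False ## False ## w)) = False ## False ## gen_act Gen_b w" by simp
    then show ?thesis
      using Gen_b near_trans[OF near_step[OF step_gen_act] near_step[OF step_gen_act]] by (metis one_add_one)
  qed
  from assms show ?thesis unfolding step_def using fwd near_sym by auto
qed

lemma near_lift: "near n u v \<Longrightarrow> near (2 * n) (False ## False ## u) (False ## False ## v)"
proof (induction n arbitrary: v)
  case 0
  then show ?case by (simp add: near_0)
next
  case (Suc n)
  show ?case
  proof (cases "u = v")
    case False
    then obtain w where "near n u w" "(w, v) \<in> step" using Suc.prems by (auto simp: near_Suc)
    then have "near (2 * n + 2) (False ## False ## u) (False ## False ## v)"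
      using near_trans[OF Suc.IH step_lift] by blast
    then show ?thesis by simp
  qed (simp add: near_refl)
qed

text \<open>The two missing prefixes are reached by \<open>b(1w) = 0w\<close> and \<open>a(01w) = 00w\<close>, which leave the
  tail alone.\<close>

lemma near_two_letters: "near 2 (x ## y ## w) (False ## False ## w)"
proof -
  have 1: "near 1 (x ## y ## w) (False ## y ## w)"
  proof (cases x)
    case True
    then show ?thesis using near_step[OF step_gen_act, of "x ## y ## w" Gen_b] by simp
  qed (simp add: near_refl)
  have 2: "near 1 (False ## y ## w) (False ## False ## w)"
  proof (cases y)
    case True
    then show ?thesis using near_step[OF step_gen_act, of "False ## y ## w" Gen_a] by simp
  qed (simp add: near_refl)
  show ?thesis using near_trans[OF 1 2] by (simp add: numeral_2_eq_2)
qed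

text \<open>Each two letters double the bound of the tail and add two steps at both ends, so the bound
  obeys \<open>D' = 2D + 4\<close>, \<open>D = 0\<close> initially. Hence the \<open>4^k\<close> words that arise from one word by rewriting its
  first \<open>2k\<close> letters all lie in a ball of radius \<open>4 * 2^k\<close>: the growth is at least quadratic.\<close>

lemma near_prefix:
  assumes "length p = 2 * k" "length q = 2 * k"
  shows "near (4 * 2 ^ k - 4) (p @- \<eta>) (q @- \<eta>)"
  using assms
proof (induction k arbitrary: p q)
  case 0
  then show ?case by (simp add: near_refl)
next
  case (Suc k)
  obtain x y p' where p: "p = x # y # p'" "length p' = 2 * k"
    using Suc.prems(1) by (auto simp: length_Suc_conv)
  obtain x2 y2 q' where q: "q = x2 # y2 # q'" "length q' = 2 * k"
    using Suc.prems(2) by (auto simp: length_Suc_conv)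
  have "near (2 * (4 * 2 ^ k - 4)) (False ## False ## (p' @- \<eta>)) (False ## False ## (q' @- \<eta>))"
    by (rule near_lift) (use Suc.IH p q in blast)
  from near_trans[OF near_trans[OF near_two_letters this] near_sym[OF near_two_letters]]
  have "near (2 + 2 * (4 * 2 ^ k - 4) + 2) (p @- \<eta>) (q @- \<eta>)"
    using p q by simp
  moreover have "2 + 2 * (4 * t - 4) + 2 = 4 * (2 * t) - 4" if "1 \<le> t" for t :: nat
    using that by auto
  then have "2 + 2 * (4 * 2 ^ k - 4) + 2 = (4 * 2 ^ Suc k - 4 :: nat)"
    unfolding power_Suc by (metis one_le_numeral one_le_power)
  ultimately show ?case by simp
qed

text \<open>Every vertex has at most four neighbours, so balls of a given radius have bounded size.\<close>

lemma near_ball_bound: "\<exists>K. \<forall>u. finite {v. near n u v} \<and> card {v. near n u v} \<le> K"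
proof (induction n)
  case 0
  have "{v. near 0 u v} = {u}" for u by (auto simp: near_0)
  then show ?case by (intro exI[of _ 1]) simp
next
  case (Suc n)
  then obtain K where K: "\<And>u. finite {v. near n u v}" "\<And>u. card {v. near n u v} \<le> K" by blast
  have deg: "finite (step `` {u})" "card (step `` {u}) \<le> 4" for u
  proof -
    have *: "step `` {u} = {gen_act Gen_a u, gen_act Gen_b u, gen_inv Gen_a u, gen_inv Gen_b u}"
      unfolding step_image UNIV_gen by auto
    show "finite (step `` {u})" by (simp add: *)
    show "card (step `` {u}) \<le> 4" unfolding * by (simp add: card_insert_if)
  qed
  have "finite {v. near (Suc n) u v} \<and> card {v. near (Suc n) u v} \<le> K * 4 + 1" for u
  proof -
    have eq: "{v. near (Suc n) u v} = insert u (\<Union>v\<in>{v. near n u v}. step `` {v})"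
      by (auto simp: near_Suc)
    have "card (\<Union>v\<in>{v. near n u v}. step `` {v}) \<le> (\<Sum>v\<in>{v. near n u v}. card (step `` {v}))"
      by (rule card_UN_le[OF K(1)])
    also have "\<dots> \<le> card {v. near n u v} * 4"
      using sum_bounded_above[of "{v. near n u v}" "\<lambda>v. card (step `` {v})" 4] deg by simp
    also have "\<dots> \<le> K * 4" using K(2) by simp
    finally show ?thesis
      unfolding eq using K(1) deg by (auto simp: card_insert_if)
  qed
  then show ?case by blast
qed

lemma schreier_dist_le_iff:
  assumes "u \<in> verts (schreier_graph \<xi>)" "v \<in> verts (schreier_graph \<xi>)"
  shows "graph_dist (schreier_graph \<xi>) u v \<le> n \<longleftrightarrow> near n u v"
proof
  assume le: "graph_dist (schreier_graph \<xi>) u v \<le> n"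
  obtain m where "(u, v) \<in> adj_rel (schreier_graph \<xi>) ^^ m"
    using schreier_connected[OF assms] rtrancl_imp_relpow by blast
  then have "(u, v) \<in> adj_rel (schreier_graph \<xi>) ^^ graph_dist (schreier_graph \<xi>) u v"
    unfolding graph_dist_def by (rule LeastI)
  then show "near n u v" using le relpow_adj_schreier[OF assms(1)] unfolding near_def by blast
next
  assume "near n u v"
  then show "graph_dist (schreier_graph \<xi>) u v \<le> n"
    using relpow_adj_schreier[OF assms(1)] unfolding near_def graph_dist_def
    by (meson Least_le order_trans)
qed

lemma int_lattice_dist_ge: "\<bar>x - y\<bar> \<le> int (graph_dist int_lattice x y)"
proof -
  have adj: "(x, y) \<in> adj_rel int_lattice \<longleftrightarrow> \<bar>x - y\<bar> = 1" for x y
    unfolding adj_rel_def int_lattice_def by (simp add: doubleton_eq_iff) presburger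
  have bound: "(x, y) \<in> adj_rel int_lattice ^^ n \<Longrightarrow> \<bar>x - y\<bar> \<le> int n" for n y
  proof (induction n arbitrary: y)
    case (Suc n)
    then obtain z where "\<bar>x - z\<bar> \<le> int n" "\<bar>z - y\<bar> = 1" using adj by auto
    then show ?case by simp
  qed simp
  have "\<exists>n. (x, y) \<in> adj_rel int_lattice ^^ n"
  proof (induction y rule: int_induct[where k = x])
    case base
    show ?case by (rule exI[of _ 0]) simp
  next
    case (step1 i)
    then obtain n where "(x, i) \<in> adj_rel int_lattice ^^ n" by blast
    then show ?case using adj[of i "i + 1"] by (intro exI[of _ "Suc n"]) auto
  next
    case (step2 i)
    then obtain n where "(x, i) \<in> adj_rel int_lattice ^^ n" by blast
    then show ?case using adj[of i "i - 1"] by (intro exI[of _ "Suc n"]) auto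
  qed
  then have "(x, y) \<in> adj_rel int_lattice ^^ graph_dist int_lattice x y"
    unfolding graph_dist_def by (rule LeastI_ex)
  then show ?thesis by (rule bound)
qed

text \<open>A quasi-isometry to the integers has fibres of bounded diameter, hence of bounded
  cardinality, and it maps a ball of radius \<open>r\<close> into an interval of length \<open>O(r)\<close>. So balls would grow
  linearly, against the quadratic lower bound above.\<close>

lemma schreier_not_quasi_isometric_int:
  "\<not> quasi_isometric_graphs (schreier_graph \<xi>) int_lattice"
proof
  let ?V = "verts (schreier_graph \<xi>)"
  let ?d = "graph_dist (schreier_graph \<xi>)"
  assume "quasi_isometric_graphs (schreier_graph \<xi>) int_lattice"
  then obtain f :: "bool stream \<Rightarrow> int" and C D :: real where C: "C \<ge> 1" "D \<ge> 0"
    and lo: "\<And>x y. x \<in> ?V \<Longrightarrow> y \<in> ?V \<Longrightarrow> ?d x y / C - D \<le> graph_dist int_lattice (f x) (f y)"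
    and hi: "\<And>x y. x \<in> ?V \<Longrightarrow> y \<in> ?V \<Longrightarrow> graph_dist int_lattice (f x) (f y) \<le> C * ?d x y + D"
    unfolding quasi_isometric_graphs_def quasi_isometry_def by blast
  obtain K where K: "\<And>u. finite {v. near (nat \<lceil>C * D\<rceil>) u v}"
      "\<And>u. card {v. near (nat \<lceil>C * D\<rceil>) u v} \<le> K"
    using near_ball_bound by blast
  have fibre: "near (nat \<lceil>C * D\<rceil>) x y" if "x \<in> ?V" "y \<in> ?V" "f x = f y" for x y
  proof -
    have "graph_dist int_lattice (f y) (f y) = 0"
      unfolding graph_dist_def by (rule Least_eq_0) simp
    then have "?d x y / C \<le> D" using lo[OF that(1,2)] that(3) by simp
    then have "?d x y \<le> C * D" using C by (simp add: field_simps)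
    then have "?d x y \<le> nat \<lceil>C * D\<rceil>" by linarith
    then show ?thesis using schreier_dist_le_iff that by blast
  qed
  \<comment> \<open>Count the \<open>4^k\<close> words with the tail of \<open>\<xi>\<close> beyond position \<open>2k\<close> through their images.\<close>
  have main: "2 ^ k \<le> real K * (8 * C + 2 * D + 3)" for k
  proof -
    define W where "W = (\<lambda>p. p @- sdrop (2 * k) \<xi>) ` {p :: bool list. length p = 2 * k}"
    define R where "R = nat \<lceil>C * (4 * 2 ^ k) + D\<rceil>"
    have "inj_on (\<lambda>p. p @- sdrop (2 * k) \<xi>) {p :: bool list. length p = 2 * k}"
      by (rule inj_on_inverseI[where g = "stake (2 * k)"]) (auto simp: stake_shift)
    then have card_W: "card W = 2 ^ (2 * k)"
      using card_lists_length_eq[of "UNIV :: bool set" "2 * k"] unfolding W_def by (simp add: card_image)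
    have fin_W: "finite W"
      using finite_lists_length_eq[of "UNIV :: bool set" "2 * k"] unfolding W_def by simp
    have near_W: "near (4 * 2 ^ k) \<xi> w" if "w \<in> W" for w
    proof -
      obtain p where p: "length p = 2 * k" "w = p @- sdrop (2 * k) \<xi>"
        using \<open>w \<in> W\<close> unfolding W_def by blast
      have "near (4 * 2 ^ k - 4) (stake (2 * k) \<xi> @- sdrop (2 * k) \<xi>) w"
        unfolding p(2) by (rule near_prefix) (simp_all add: p)
      then have "near (4 * 2 ^ k - 4) \<xi> w" by (simp add: stake_sdrop)
      then show ?thesis by (rule near_mono) simp
    qed
    have \<xi>V: "\<xi> \<in> ?V" by (simp add: verts_schreier)
    have WV: "w \<in> ?V" if "w \<in> W" for w
      using near_imp_rtrancl[OF near_W[OF that]] by (simp add: verts_schreier)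
    have "f ` W \<subseteq> {f \<xi> - int R..f \<xi> + int R}"
    proof (clarify)
      fix w assume w: "w \<in> W"
      have "?d \<xi> w \<le> 4 * 2 ^ k" using near_W[OF w] schreier_dist_le_iff[OF \<xi>V WV[OF w]] by blast
      then have "real (?d \<xi> w) \<le> 4 * 2 ^ k" using of_nat_mono by fastforce
      then have "C * ?d \<xi> w \<le> C * (4 * 2 ^ k)" using C by (intro mult_left_mono) auto
      then have "real (graph_dist int_lattice (f \<xi>) (f w)) \<le> C * (4 * 2 ^ k) + D"
        using hi[OF \<xi>V WV[OF w]] by linarith
      then have "int (graph_dist int_lattice (f \<xi>) (f w)) \<le> int R" unfolding R_def by linarith
      then have "\<bar>f \<xi> - f w\<bar> \<le> int R" using int_lattice_dist_ge[of "f \<xi>" "f w"] by linarith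
      then show "f w \<in> {f \<xi> - int R..f \<xi> + int R}" by auto
    qed
    then have "card (f ` W) \<le> card {f \<xi> - int R..f \<xi> + int R}" by (intro card_mono) auto
    then have card_fW: "card (f ` W) \<le> 2 * R + 1" by simp
    have "card W \<le> K * card (f ` W)"
    proof -
      have "card W \<le> (\<Sum>y\<in>f ` W. card {x \<in> W. f x = y})"
        using sum.image_gen[OF fin_W, of "\<lambda>_. 1::nat" f] by simp
      also have "\<dots> \<le> (\<Sum>y\<in>f ` W. K)"
      proof (rule sum_mono)
        fix y assume "y \<in> f ` W"
        then obtain x where x: "x \<in> W" "y = f x" by blast
        have "{x' \<in> W. f x' = y} \<subseteq> {v. near (nat \<lceil>C * D\<rceil>) x v}"
          using fibre[OF WV[OF x(1)] WV] x by auto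
        then show "card {x \<in> W. f x = y} \<le> K" using K card_mono order_trans by meson
      qed
      finally show ?thesis by (simp add: mult.commute)
    qed
    also have "\<dots> \<le> K * (2 * R + 1)" using card_fW by (intro mult_le_mono2)
    finally have "2 ^ (2 * k) \<le> K * (2 * R + 1)" using card_W by simp
    then have "real (2 ^ (2 * k)) \<le> real (K * (2 * R + 1))" by (rule of_nat_mono)
    then have le: "(2::real) ^ k * 2 ^ k \<le> real K * (2 * real R + 1)"
      unfolding mult_2[of k] power_add by (simp add: distrib_left)
    have ceiling_le: "real (nat \<lceil>x\<rceil>) \<le> x + 1" if "0 \<le> x" for x :: real
      using that by linarith
    have "real R \<le> C * (4 * 2 ^ k) + D + 1" unfolding R_def by (rule ceiling_le) (use C in simp)
    also have "\<dots> \<le> C * (4 * 2 ^ k) + (D + 1) * 2 ^ k"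
      using mult_left_mono[of 1 "2 ^ k" "D + 1"] C by simp
    finally have "2 * real R + 1 \<le> (8 * C + 2 * D + 2) * 2 ^ k + 1" by (simp add: algebra_simps)
    also have "\<dots> \<le> (8 * C + 2 * D + 3) * 2 ^ k"
      using one_le_power[of "2::real" k] by (simp add: algebra_simps)
    finally have "2 * real R + 1 \<le> (8 * C + 2 * D + 3) * 2 ^ k" .
    then have "real K * (2 * real R + 1) \<le> real K * ((8 * C + 2 * D + 3) * 2 ^ k)"
      by (rule mult_left_mono) simp
    with le have "(2::real) ^ k * 2 ^ k \<le> (real K * (8 * C + 2 * D + 3)) * 2 ^ k"
      unfolding mult.assoc by (rule order_trans)
    then show ?thesis by (rule mult_right_le_imp_le) simp
  qed
  obtain k where "real K * (8 * C + 2 * D + 3) < 2 ^ k"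
    using real_arch_pow[of 2] by force
  then show False using main[of k] by simp
qed

section \<open>Cut vertices and isomorphisms\<close>

lemma sym_adj_rel: "(u, v) \<in> adj_rel G \<Longrightarrow> (v, u) \<in> adj_rel G"
  by (auto simp: adj_rel_def insert_commute)

text \<open>A cut vertex here separates the rest of the graph into two infinite parts; plain cut vertices
  occur in abundance inside finite decorations.\<close>

definition cut_vertex :: "('v, 'e) multigraph \<Rightarrow> 'v \<Rightarrow> bool" where
  "cut_vertex G v \<longleftrightarrow> (\<exists>A B. verts G - {v} = A \<union> B \<and> A \<inter> B = {} \<and> infinite A \<and> infinite B \<and>
     (\<forall>x\<in>A. \<forall>y\<in>B. (x, y) \<notin> adj_rel G))"

lemma cut_vertex_image:
  assumes bij: "bij_betw f (verts G) (verts H)" and v: "v \<in> verts G"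
    and adj: "\<And>x y. x \<in> verts G \<Longrightarrow> y \<in> verts G \<Longrightarrow>
                (f x, f y) \<in> adj_rel H \<longleftrightarrow> (x, y) \<in> adj_rel G"
  shows "cut_vertex H (f v) \<longleftrightarrow> cut_vertex G v"
proof
  have inj: "inj_on f (verts G)" and im: "f ` verts G = verts H"
    using bij by (auto simp: bij_betw_def)
  {
    assume "cut_vertex G v"
    then obtain A B where AB: "verts G - {v} = A \<union> B" "A \<inter> B = {}" "infinite A" "infinite B"
        "\<forall>x\<in>A. \<forall>y\<in>B. (x, y) \<notin> adj_rel G"
      unfolding cut_vertex_def by blast
    have sub: "A \<subseteq> verts G" "B \<subseteq> verts G" using AB(1) by auto
    have "verts H - {f v} = f ` (verts G - {v})"
      using inj_on_image_set_diff[OF inj, of "verts G" "{v}"] v im by simp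
    then have "verts H - {f v} = f ` A \<union> f ` B" using AB(1) by (simp add: image_Un)
    moreover have "f ` A \<inter> f ` B = {}"
      using inj_on_image_Int[OF inj sub] AB(2) by simp
    moreover have "infinite (f ` A)" "infinite (f ` B)"
      using AB(3,4) sub inj by (auto simp: finite_image_iff inj_on_subset)
    moreover have "\<forall>x\<in>f ` A. \<forall>y\<in>f ` B. (x, y) \<notin> adj_rel H"
      using AB(5) sub adj by blast
    ultimately show "cut_vertex H (f v)" unfolding cut_vertex_def by blast
  }
  {
    assume "cut_vertex H (f v)"
    then obtain A B where AB: "verts H - {f v} = A \<union> B" "A \<inter> B = {}" "infinite A" "infinite B"
        "\<forall>x\<in>A. \<forall>y\<in>B. (x, y) \<notin> adj_rel H"
      unfolding cut_vertex_def by blast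
    let ?A = "{x \<in> verts G. f x \<in> A}" and ?B = "{x \<in> verts G. f x \<in> B}"
    have preimage: "infinite {x \<in> verts G. f x \<in> X}" if "infinite X" "X \<subseteq> f ` verts G" for X
    proof
      assume "finite {x \<in> verts G. f x \<in> X}"
      then have "finite (f ` {x \<in> verts G. f x \<in> X})" by (rule finite_imageI)
      moreover have "X \<subseteq> f ` {x \<in> verts G. f x \<in> X}" using that(2) by blast
      ultimately show False using that(1) finite_subset by blast
    qed
    have "A \<subseteq> f ` verts G" "B \<subseteq> f ` verts G" using AB(1) unfolding im by blast+
    then have "infinite ?A" "infinite ?B" using preimage AB(3,4) by blast+
    moreover have "verts G - {v} = ?A \<union> ?B"
    proof -
      have "f x \<in> A \<union> B \<longleftrightarrow> x \<noteq> v" if "x \<in> verts G" for x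
        using AB(1) im that v inj_onD[OF inj, of x v] by (metis Diff_iff imageI singleton_iff)
      then show ?thesis using v by auto
    qed
    moreover have "?A \<inter> ?B = {}" using AB(2) by auto
    moreover have "\<forall>x\<in>?A. \<forall>y\<in>?B. (x, y) \<notin> adj_rel G" using AB(5) adj by blast
    ultimately show "cut_vertex G v" unfolding cut_vertex_def by blast
  }
qed

lemma graph_iso_adj:
  assumes "graph_iso G H" and wf: "\<And>e. e \<in> edges G \<Longrightarrow> endpts G e \<subseteq> verts G"
  obtains f where "bij_betw f (verts G) (verts H)"
    "\<And>x y. x \<in> verts G \<Longrightarrow> y \<in> verts G \<Longrightarrow> (f x, f y) \<in> adj_rel H \<longleftrightarrow> (x, y) \<in> adj_rel G"
proof -
  from assms(1) obtain f g where f: "bij_betw f (verts G) (verts H)"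
      and g: "bij_betw g (edges G) (edges H)"
      and e: "\<And>e. e \<in> edges G \<Longrightarrow> endpts H (g e) = f ` endpts G e"
    unfolding graph_iso_def by blast
  have "(f x, f y) \<in> adj_rel H \<longleftrightarrow> (x, y) \<in> adj_rel G" if "x \<in> verts G" "y \<in> verts G" for x y
  proof -
    have "(f x, f y) \<in> adj_rel H \<longleftrightarrow> (\<exists>e\<in>g ` edges G. endpts H e = {f x, f y})"
      using g by (simp add: adj_rel_def bij_betw_def)
    also have "\<dots> \<longleftrightarrow> (\<exists>e\<in>edges G. f ` endpts G e = f ` {x, y})" using e by auto
    also have "\<dots> \<longleftrightarrow> (\<exists>e\<in>edges G. endpts G e = {x, y})"
    proof (rule bex_cong[OF refl])
      fix e assume "e \<in> edges G"
      then have "endpts G e \<subseteq> verts G" "{x, y} \<subseteq> verts G" using wf that by auto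
      moreover have "inj_on f (verts G)" using f by (simp add: bij_betw_def)
      ultimately show "f ` endpts G e = f ` {x, y} \<longleftrightarrow> endpts G e = {x, y}"
        by (intro inj_on_image_eq_iff)
    qed
    finally show ?thesis by (simp add: adj_rel_def)
  qed
  then show thesis using f that by blast
qed

section \<open>Lines with finite decorations\<close>

text \<open>A bi-infinite line to which finite pieces are attached. The position \<open>pos\<close> is that of the
  foot of a vertex on the line, and the only edges along which it changes are the edges of the line
  itself: every piece hangs on the rest of the graph by a single vertex.\<close>

locale decorated_line =
  fixes G :: "('v, 'e) multigraph" and pos :: "'v \<Rightarrow> int" and line :: "int \<Rightarrow> 'v"
  assumes endpts_verts: "e \<in> edges G \<Longrightarrow> endpts G e \<subseteq> verts G"
    and line_verts: "line i \<in> verts G"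
    and pos_line: "pos (line i) = i"
    and line_adj: "(line i, line (i + 1)) \<in> adj_rel G"
    and adj_pos: "(u, v) \<in> adj_rel G \<Longrightarrow>
          pos u = pos v \<or> u = line (pos u) \<and> v = line (pos v) \<and> \<bar>pos u - pos v\<bar> = 1"
    and finite_fibre: "finite {u \<in> verts G. pos u = i}"
    and connected_line: "u \<in> verts G \<Longrightarrow> (u, line 0) \<in> (adj_rel G)\<^sup>*"
begin

lemma adj_verts: "(u, v) \<in> adj_rel G \<Longrightarrow> u \<in> verts G \<and> v \<in> verts G"
  using endpts_verts by (fastforce simp: adj_rel_def)

lemma line_inj: "line i = line j \<longleftrightarrow> i = j"
  by (metis pos_line)

section \<open>Ends of a decorated line\<close>

lemma line_segment_connected:
  assumes "i \<le> j" and "\<And>k. i \<le> k \<Longrightarrow> k \<le> j \<Longrightarrow> line k \<notin> S"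
  shows "(line i, line j) \<in> (Restr (adj_rel G) (verts G - S))\<^sup>*"
  using assms
proof (induction j rule: int_ge_induct)
  case (step j)
  then have "(line i, line j) \<in> (Restr (adj_rel G) (verts G - S))\<^sup>*" by simp
  moreover have "(line j, line (j + 1)) \<in> Restr (adj_rel G) (verts G - S)"
    using step line_adj line_verts by simp
  ultimately show ?case by (rule rtrancl_into_rtrancl)
qed simp

lemma Restr_rtrancl_sym:
  "(u, v) \<in> (Restr (adj_rel G) S)\<^sup>* \<Longrightarrow> (v, u) \<in> (Restr (adj_rel G) S)\<^sup>*"
proof -
  have "sym (Restr (adj_rel G) S)" using sym_adj_rel by (auto simp: sym_def)
  then show "(u, v) \<in> (Restr (adj_rel G) S)\<^sup>* \<Longrightarrow> (v, u) \<in> (Restr (adj_rel G) S)\<^sup>*"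
    using sym_rtrancl symD by metis
qed

lemma ray_leaves_finite:
  assumes "ray G r" "finite F"
  shows "\<exists>N. \<forall>n\<ge>N. r n \<notin> F"
proof -
  have "finite {n. r n \<in> F}"
    using assms finite_vimageI[of F r] by (simp add: ray_def vimage_def)
  then obtain N where "\<forall>n\<in>{n. r n \<in> F}. n < N"
    using finite_nat_set_iff_bounded by auto
  then show ?thesis by (metis leD mem_Collect_eq)
qed

lemma finite_pos_bounded: "finite {u \<in> verts G. \<bar>pos u\<bar> \<le> M}"
proof -
  have "{u \<in> verts G. \<bar>pos u\<bar> \<le> M} = (\<Union>i\<in>{-M..M}. {u \<in> verts G. pos u = i})" by auto
  then show ?thesis using finite_fibre by simp
qed

definition to_right :: "(nat \<Rightarrow> 'v) \<Rightarrow> bool" where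
  "to_right r \<longleftrightarrow> (\<forall>M. \<exists>N. \<forall>n\<ge>N. pos (r n) > M)"

definition to_left :: "(nat \<Rightarrow> 'v) \<Rightarrow> bool" where
  "to_left r \<longleftrightarrow> (\<forall>M. \<exists>N. \<forall>n\<ge>N. pos (r n) < M)"

lemma ray_step: "ray G r \<Longrightarrow> (r n, r (Suc n)) \<in> adj_rel G"
  by (simp add: ray_def)

lemma ray_verts: "ray G r \<Longrightarrow> r n \<in> verts G"
  by (auto simp: ray_def)

text \<open>A ray is injective and the fibres of the position are finite, so the absolute value of the
  position tends to infinity; it changes by at most one per edge, so its sign is eventually constant.\<close>

lemma ray_right_or_left:
  assumes "ray G r"
  shows "to_right r \<or> to_left r"
proof -
  have ev: "\<exists>N. \<forall>n\<ge>N. \<bar>pos (r n)\<bar> > M" for M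
    using ray_leaves_finite[OF assms finite_pos_bounded[of M]] ray_verts[OF assms] by fastforce
  \<comment> \<open>A path that stays at distance more than \<open>M \<ge> 0\<close> from the origin cannot change sides.\<close>
  have const: "(\<forall>n\<ge>N. pos (r n) > M) \<or> (\<forall>n\<ge>N. pos (r n) < - M)"
    if N: "\<forall>n\<ge>N. \<bar>pos (r n)\<bar> > M" and M: "M \<ge> 0" for N M
  proof -
    have same: "pos (r n) > M \<longleftrightarrow> pos (r N) > M" if "n \<ge> N" for n
      using that
    proof (induction n rule: dec_induct)
      case (step n)
      have "\<bar>pos (r n)\<bar> > M" "\<bar>pos (r (Suc n))\<bar> > M" using N step by auto
      then show ?case using adj_pos[OF ray_step[OF assms, of n]] step.IH M by linarith
    qed simp
    show ?thesis
    proof (cases "pos (r N) > M")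
      case True
      then show ?thesis using same by blast
    next
      case False
      then have "pos (r n) < - M" if "n \<ge> N" for n using same[OF that] N that by force
      then show ?thesis by blast
    qed
  qed
  obtain N0 where N0: "\<forall>n\<ge>N0. \<bar>pos (r n)\<bar> > 0" using ev by blast
  from const[OF N0] show ?thesis
  proof
    assume right: "\<forall>n\<ge>N0. pos (r n) > 0"
    have "\<exists>N. \<forall>n\<ge>N. pos (r n) > M" for M
    proof -
      obtain N where N: "\<forall>n\<ge>N. \<bar>pos (r n)\<bar> > M" using ev by blast
      have "pos (r n) > M" if "n \<ge> max N N0" for n
      proof -
        have "\<bar>pos (r n)\<bar> > M" "pos (r n) > 0" using that N right by auto
        then show ?thesis by linarith
      qed
      then show ?thesis by blast
    qed
    then show ?thesis by (simp add: to_right_def)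
  next
    assume left: "\<forall>n\<ge>N0. pos (r n) < - 0"
    have "\<exists>N. \<forall>n\<ge>N. pos (r n) < M" for M
    proof -
      obtain N where N: "\<forall>n\<ge>N. \<bar>pos (r n)\<bar> > - M" using ev by blast
      have "pos (r n) < M" if "n \<ge> max N N0" for n
      proof -
        have "\<bar>pos (r n)\<bar> > - M" "pos (r n) < 0" using that N left by auto
        then show ?thesis by linarith
      qed
      then show ?thesis by blast
    qed
    then show ?thesis by (simp add: to_left_def)
  qed simp
qed

lemma not_right_and_left: "\<not> (to_right r \<and> to_left r)"
proof
  assume "to_right r \<and> to_left r"
  then obtain N N' where "\<forall>n\<ge>N. pos (r n) > 0" "\<forall>n\<ge>N'. pos (r n) < 0"
    unfolding to_right_def to_left_def by metis
  then have "pos (r (max N N')) > 0" "pos (r (max N N')) < 0" by auto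
  then show False by simp
qed

lemma ray_tail_connected:
  assumes "ray G r" "m \<le> n" "\<And>k. k \<ge> m \<Longrightarrow> r k \<notin> S"
  shows "(r m, r n) \<in> (Restr (adj_rel G) (verts G - S))\<^sup>*"
  using assms(2)
proof (induction n rule: dec_induct)
  case (step n)
  have "(r n, r (Suc n)) \<in> Restr (adj_rel G) (verts G - S)"
    using step assms(3) ray_step[OF assms(1)] ray_verts[OF assms(1)] by simp
  with step.IH show ?case by (rule rtrancl_into_rtrancl)
qed simp

text \<open>Away from the line the position is constant, and a ray cannot remain in one finite fibre.\<close>

lemma ray_meets_line:
  assumes "ray G r"
  shows "\<exists>n\<ge>m. r n = line (pos (r n))"
proof (rule ccontr)
  assume "\<not> ?thesis"
  then have off: "\<And>n. n \<ge> m \<Longrightarrow> r n \<noteq> line (pos (r n))" by blast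
  have "pos (r n) = pos (r m)" if "n \<ge> m" for n
    using that
  proof (induction n rule: dec_induct)
    case (step n)
    then show ?case using adj_pos[OF ray_step[OF assms, of n]] off[of n] by auto
  qed simp
  then show False
    using ray_leaves_finite[OF assms finite_fibre[of "pos (r m)"]] ray_verts[OF assms]
    by (metis (mono_tags, lifting) max.cobounded1 max.cobounded2 mem_Collect_eq)
qed

lemma finite_pos_bound: "finite S \<Longrightarrow> \<exists>M. \<forall>u\<in>S. \<bar>pos u\<bar> \<le> M"
  by (metis (no_types, lifting) Max_ge finite_imageI image_eqI)

text \<open>Beyond the finite set a right-going ray can be followed until it meets the line, and from there
  the line leads back to \<open>line (M + 1)\<close>. All right-going rays are thus joined through this one vertex.\<close>

lemma to_right_connected:
  assumes r: "ray G r" and S: "\<forall>u\<in>S. \<bar>pos u\<bar> \<le> M" and m: "\<forall>n\<ge>m. pos (r n) > M"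
  shows "(r m, line (M + 1)) \<in> (Restr (adj_rel G) (verts G - S))\<^sup>*"
proof -
  obtain n where n: "n \<ge> m" "r n = line (pos (r n))" using ray_meets_line[OF r] by blast
  have "(r m, r n) \<in> (Restr (adj_rel G) (verts G - S))\<^sup>*"
    by (rule ray_tail_connected[OF r n(1)]) (use S m in fastforce)
  moreover have "(line (M + 1), line (pos (r n))) \<in> (Restr (adj_rel G) (verts G - S))\<^sup>*"
  proof (rule line_segment_connected)
    show "M + 1 \<le> pos (r n)" using m n(1) by fastforce
    show "line k \<notin> S" if "M + 1 \<le> k" for k
      using S pos_line[of k] that by force
  qed
  ultimately show ?thesis using n(2) Restr_rtrancl_sym by (metis rtrancl_trans)
qed

lemma to_left_connected:
  assumes r: "ray G r" and S: "\<forall>u\<in>S. \<bar>pos u\<bar> \<le> M" and m: "\<forall>n\<ge>m. pos (r n) < - M"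
  shows "(r m, line (- M - 1)) \<in> (Restr (adj_rel G) (verts G - S))\<^sup>*"
proof -
  obtain n where n: "n \<ge> m" "r n = line (pos (r n))" using ray_meets_line[OF r] by blast
  have "(r m, r n) \<in> (Restr (adj_rel G) (verts G - S))\<^sup>*"
    by (rule ray_tail_connected[OF r n(1)]) (use S m in fastforce)
  moreover have "(line (pos (r n)), line (- M - 1)) \<in> (Restr (adj_rel G) (verts G - S))\<^sup>*"
  proof (rule line_segment_connected)
    show "pos (r n) \<le> - M - 1" using m n(1) by fastforce
    show "line k \<notin> S" if "k \<le> - M - 1" for k
      using S pos_line[of k] that by force
  qed
  ultimately show ?thesis using n(2) by (metis rtrancl_trans)
qed

text \<open>The only way from the positive side to the rest passes through \<open>line 0\<close>.\<close>

lemma right_side_closed: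
  assumes "(u, v) \<in> (Restr (adj_rel G) (verts G - {line 0}))\<^sup>*" "pos u > 0"
  shows "pos v > 0"
  using assms
proof induction
  case (step v w)
  then have v: "pos v > 0" and vw: "(v, w) \<in> adj_rel G" "w \<noteq> line 0" by auto
  from adj_pos[OF vw(1)] show ?case
  proof
    assume a: "v = line (pos v) \<and> w = line (pos w) \<and> \<bar>pos v - pos w\<bar> = 1"
    then have "pos w \<noteq> 0" using vw(2) by metis
    then show ?thesis using a v by linarith
  qed (use v in simp)
qed

lemma ray_equiv_iff:
  assumes r: "ray G r" and r': "ray G r'"
  shows "(r, r') \<in> ray_equiv G \<longleftrightarrow> (to_right r \<longleftrightarrow> to_right r')"
proof -
  have split_apart: "(r, r') \<notin> ray_equiv G" "(r', r) \<notin> ray_equiv G"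
    if right: "to_right r" and left: "to_left r'" for r r'
  proof -
    obtain N1 where N1: "\<forall>n\<ge>N1. pos (r n) > 0" using right unfolding to_right_def by blast
    obtain N2 where N2: "\<forall>n\<ge>N2. pos (r' n) < 0" using left unfolding to_left_def by blast
    have sep: "(r m, r' n) \<notin> (Restr (adj_rel G) (verts G - {line 0}))\<^sup>*"
      if "m \<ge> N1" "n \<ge> N2" for m n
      using right_side_closed N1 N2 that by (metis less_asym)
    show "(r, r') \<notin> ray_equiv G"
    proof
      assume "(r, r') \<in> ray_equiv G"
      then obtain N where "\<forall>m\<ge>N. \<forall>n\<ge>N. (r m, r' n) \<in> (Restr (adj_rel G) (verts G - {line 0}))\<^sup>*"
        unfolding ray_equiv_def by blast
      then show False
        using sep[of "N + N1 + N2" "N + N1 + N2"] by simp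
    qed
    show "(r', r) \<notin> ray_equiv G"
    proof
      assume "(r', r) \<in> ray_equiv G"
      then obtain N where "\<forall>m\<ge>N. \<forall>n\<ge>N. (r' m, r n) \<in> (Restr (adj_rel G) (verts G - {line 0}))\<^sup>*"
        unfolding ray_equiv_def by blast
      then show False
        using sep[of "N + N1 + N2" "N + N1 + N2"] Restr_rtrancl_sym by simp
    qed
  qed
  have right: "(r, r') \<in> ray_equiv G" if "to_right r" "to_right r'"
  proof -
    have "\<exists>N. \<forall>m\<ge>N. \<forall>n\<ge>N. (r m, r' n) \<in> (Restr (adj_rel G) (verts G - S))\<^sup>*" if S: "finite S" for S
    proof -
      obtain M where M: "\<forall>u\<in>S. \<bar>pos u\<bar> \<le> M" using finite_pos_bound[OF S] by blast
      obtain N1 where N1: "\<forall>n\<ge>N1. pos (r n) > M" using \<open>to_right r\<close> unfolding to_right_def by blast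
      obtain N2 where N2: "\<forall>n\<ge>N2. pos (r' n) > M" using \<open>to_right r'\<close> unfolding to_right_def by blast
      have "(r m, r' n) \<in> (Restr (adj_rel G) (verts G - S))\<^sup>*" if "m \<ge> max N1 N2" "n \<ge> max N1 N2" for m n
      proof -
        have "(r m, line (M + 1)) \<in> (Restr (adj_rel G) (verts G - S))\<^sup>*"
          using to_right_connected[OF r M, of m] N1 that by simp
        moreover have "(r' n, line (M + 1)) \<in> (Restr (adj_rel G) (verts G - S))\<^sup>*"
          using to_right_connected[OF r' M, of n] N2 that by simp
        ultimately show ?thesis using Restr_rtrancl_sym by (metis rtrancl_trans)
      qed
      then show ?thesis by blast
    qed
    then show ?thesis using r r' unfolding ray_equiv_def by blast
  qed
  have left: "(r, r') \<in> ray_equiv G" if "to_left r" "to_left r'"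
  proof -
    have "\<exists>N. \<forall>m\<ge>N. \<forall>n\<ge>N. (r m, r' n) \<in> (Restr (adj_rel G) (verts G - S))\<^sup>*" if S: "finite S" for S
    proof -
      obtain M where M: "\<forall>u\<in>S. \<bar>pos u\<bar> \<le> M" using finite_pos_bound[OF S] by blast
      obtain N1 where N1: "\<forall>n\<ge>N1. pos (r n) < - M" using \<open>to_left r\<close> unfolding to_left_def by blast
      obtain N2 where N2: "\<forall>n\<ge>N2. pos (r' n) < - M" using \<open>to_left r'\<close> unfolding to_left_def by blast
      have "(r m, r' n) \<in> (Restr (adj_rel G) (verts G - S))\<^sup>*" if "m \<ge> max N1 N2" "n \<ge> max N1 N2" for m n
      proof -
        have "(r m, line (- M - 1)) \<in> (Restr (adj_rel G) (verts G - S))\<^sup>*"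
          using to_left_connected[OF r M, of m] N1 that by simp
        moreover have "(r' n, line (- M - 1)) \<in> (Restr (adj_rel G) (verts G - S))\<^sup>*"
          using to_left_connected[OF r' M, of n] N2 that by simp
        ultimately show ?thesis using Restr_rtrancl_sym by (metis rtrancl_trans)
      qed
      then show ?thesis by blast
    qed
    then show ?thesis using r r' unfolding ray_equiv_def by blast
  qed
  show ?thesis
    using ray_right_or_left[OF r] ray_right_or_left[OF r'] not_right_and_left split_apart right left
    by metis
qed

lemma two_ended: "card (graph_ends G) = 2"
proof -
  let ?p = "\<lambda>n. line (int n)" and ?q = "\<lambda>n. line (- int n)"
  have p: "ray G ?p"
    using line_adj[of "int _"] line_verts by (auto simp: ray_def inj_def line_inj add.commute)
  have q: "ray G ?q"
  proof -
    have "(?q n, ?q (Suc n)) \<in> adj_rel G" for n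
      using sym_adj_rel[OF line_adj[of "- int (Suc n)"]] by simp
    then show ?thesis using line_verts by (auto simp: ray_def inj_def line_inj)
  qed
  have right_p: "to_right ?p"
  proof -
    have "pos (?p n) > M" if "n \<ge> nat (M + 1)" for n M using that by (simp add: pos_line)
    then show ?thesis unfolding to_right_def by blast
  qed
  have "to_left ?q"
  proof -
    have "pos (?q n) < M" if "n \<ge> nat (1 - M)" for n M using that by (simp add: pos_line)
    then show ?thesis unfolding to_left_def by blast
  qed
  then have left_q: "\<not> to_right ?q" using not_right_and_left by blast
  have cls: "ray_equiv G `` {r} = {r'. ray G r' \<and> (to_right r' \<longleftrightarrow> to_right r)}" if "ray G r" for r
  proof -
    have "(r, r') \<in> ray_equiv G \<Longrightarrow> ray G r'" for r' by (simp add: ray_equiv_def)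
    then show ?thesis using ray_equiv_iff[OF that] by blast
  qed
  have "graph_ends G = {{r. ray G r \<and> to_right r}, {r. ray G r \<and> \<not> to_right r}}"
  proof (intro equalityI subsetI)
    fix c assume "c \<in> graph_ends G"
    then obtain r where "ray G r" "c = ray_equiv G `` {r}" by (auto simp: graph_ends_def quotient_def)
    then show "c \<in> {{r. ray G r \<and> to_right r}, {r. ray G r \<and> \<not> to_right r}}"
      using cls by (cases "to_right r") auto
  next
    fix c assume "c \<in> {{r. ray G r \<and> to_right r}, {r. ray G r \<and> \<not> to_right r}}"
    then have "c = ray_equiv G `` {?p} \<or> c = ray_equiv G `` {?q}"
      unfolding cls[OF p] cls[OF q] using right_p left_q by auto
    then show "c \<in> graph_ends G" using p q by (auto simp: graph_ends_def quotient_def)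
  qed
  moreover have "{r. ray G r \<and> to_right r} \<noteq> {r. ray G r \<and> \<not> to_right r}"
    using p right_p by blast
  ultimately show ?thesis by simp
qed

section \<open>Rigidity of decorated lines\<close>

lemma cut_vertex_line: "cut_vertex G (line i)"
proof -
  let ?A = "{u \<in> verts G. pos u > i}" and ?B = "{u \<in> verts G. pos u \<le> i} - {line i}"
  have "line ` {i<..} \<subseteq> ?A" using line_verts pos_line by auto
  moreover have "infinite (line ` {i<..})"
    using infinite_Ioi[of i] by (simp add: finite_image_iff inj_on_def line_inj)
  ultimately have A: "infinite ?A" using finite_subset by blast
  have "line ` {..<i} \<subseteq> ?B" using line_verts pos_line by (auto simp: line_inj)
  moreover have "infinite (line ` {..<i})"
    using infinite_Iio[of i] by (simp add: finite_image_iff inj_on_def line_inj)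
  ultimately have B: "infinite ?B" using finite_subset by blast
  have "(x, y) \<notin> adj_rel G" if "x \<in> ?A" "y \<in> ?B" for x y
  proof
    assume "(x, y) \<in> adj_rel G"
    from adj_pos[OF this] show False
    proof
      assume "x = line (pos x) \<and> y = line (pos y) \<and> \<bar>pos x - pos y\<bar> = 1"
      moreover from this that have "pos y = i" by auto
      ultimately show False using that(2) by blast
    qed (use that in auto)
  qed
  moreover have "verts G - {line i} = ?A \<union> ?B" using pos_line by auto
  ultimately show ?thesis unfolding cut_vertex_def
    using A B by (intro exI[of _ ?A] exI[of _ ?B]) auto
qed

text \<open>Removing a vertex inside a decoration leaves the line in one piece, and every vertex of another
  fibre reaches the line without leaving its fibre. So the part that avoids the line is
  contained in one finite fibre.\<close>

lemma cut_vertex_imp_line: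
  assumes v: "v \<in> verts G" and cut: "cut_vertex G v"
  shows "v = line (pos v)"
proof (rule ccontr)
  assume off: "v \<noteq> line (pos v)"
  then have off': "v \<noteq> line i" for i using pos_line by metis
  from cut obtain A B where AB: "verts G - {v} = A \<union> B" "A \<inter> B = {}" "infinite A" "infinite B"
      "\<forall>x\<in>A. \<forall>y\<in>B. (x, y) \<notin> adj_rel G"
    unfolding cut_vertex_def by blast
  \<comment> \<open>The roles of the two parts are symmetric; only the position of the line distinguishes them.\<close>
  have *: "finite A" if AB: "verts G - {v} = A \<union> B" "A \<inter> B = {}"
      "\<And>x y. x \<in> A \<Longrightarrow> y \<in> B \<Longrightarrow> (x, y) \<notin> adj_rel G" and L: "line 0 \<in> B" for A B
  proof -
    have same_side: "u \<in> B \<longleftrightarrow> w \<in> B" if "(u, w) \<in> adj_rel G" "u \<noteq> v" "w \<noteq> v" for u w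
      using AB that adj_verts[OF that(1)] sym_adj_rel[OF that(1)] by blast
    have lineB: "line i \<in> B" for i
    proof (induction i rule: int_induct[where k = 0])
      case (step1 i)
      then show ?case using same_side[OF line_adj[of i]] off' by metis
    next
      case (step2 i)
      then show ?case using same_side[OF line_adj[of "i - 1"]] off'[of i] off'[of "i - 1"] by auto
    qed (rule L)
    have "pos u = pos v \<or> u \<in> B" if "u \<in> verts G" for u
      using connected_line[OF that]
    proof (induction rule: converse_rtrancl_induct)
      case base
      then show ?case using L by simp
    next
      case (step u w)
      show ?case
      proof (cases "u = line (pos u)")
        case True
        then show ?thesis using lineB by metis
      next
        case False
        then have "pos u = pos w" using adj_pos[OF step(1)] by blast
        moreover have "w \<noteq> v" if "w \<in> B" using AB(1) that by blast
        ultimately show ?thesis using step(3) same_side[OF step(1)] by metis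
      qed
    qed
    then have "A \<subseteq> {u \<in> verts G. pos u = pos v}" using AB by blast
    then show ?thesis using finite_fibre finite_subset by blast
  qed
  have "line 0 \<in> A \<union> B" using AB(1) line_verts off' by blast
  then show False
  proof
    assume L: "line 0 \<in> B"
    have "(x, y) \<notin> adj_rel G" if "x \<in> A" "y \<in> B" for x y
      using AB(5) that by blast
    from *[OF AB(1,2) this L] AB(3) show False by simp
  next
    assume L: "line 0 \<in> A"
    have eq: "verts G - {v} = B \<union> A" "B \<inter> A = {}" using AB(1,2) by auto
    have "(x, y) \<notin> adj_rel G" if "x \<in> B" "y \<in> A" for x y
      using AB(5) that sym_adj_rel[of x y G] by blast
    from *[OF eq this L] AB(4) show False by simp
  qed
qed

end

text \<open>A step cannot be followed by its reversal without violating injectivity, so all steps agree.\<close>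

lemma injective_unit_steps_affine:
  fixes g :: "int \<Rightarrow> int"
  assumes "inj g" and unit: "\<And>i. \<bar>g (i + 1) - g i\<bar> = 1"
  shows "\<exists>d\<in>{1, -1}. \<forall>i. g i = g 0 + d * i"
proof -
  define d where "d = g 1 - g 0"
  have same: "g (i + 2) - g (i + 1) = g (i + 1) - g i" for i
  proof -
    have "g (i + 2) \<noteq> g i" using injD[OF assms(1), of "i + 2" i] by auto
    moreover have "\<bar>g (i + 2) - g (i + 1)\<bar> = 1" using unit[of "i + 1"] by (simp add: add.assoc)
    ultimately show ?thesis using unit[of i] by linarith
  qed
  have const: "g (i + 1) - g i = d" for i
  proof (induction i rule: int_induct[where k = 0])
    case (step1 i)
    then show ?case using same[of i] by (simp add: add.assoc)
  next
    case (step2 i)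
    then show ?case using same[of "i - 1"] by (simp add: add.commute)
  qed (simp add: d_def)
  have "g i = g 0 + d * i" for i
  proof (induction i rule: int_induct[where k = 0])
    case (step1 i)
    then show ?case using const[of i] by (simp add: algebra_simps)
  next
    case (step2 i)
    then show ?case using const[of "i - 1"] by (simp add: algebra_simps)
  qed simp
  moreover have "d \<in> {1, -1}" using unit[of 0] d_def by auto
  ultimately show ?thesis by blast
qed

text \<open>An isomorphism preserves cut vertices, hence maps line to line, hence acts on positions by a
  translation or a reflection \<open>i \<mapsto> c + d * i\<close>. The foot of a vertex on the line is determined by
  adjacency alone, since it is constant along every edge that is not on the line and is the vertex itself on
  the line. So fibres are mapped onto fibres, and their sizes form an invariant of the graph up to
  this choice of coordinate.\<close>

lemma iso_decorated_lines:
  assumes "decorated_line G pos line" "decorated_line H pos' line'" "graph_iso G H"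
  shows "\<exists>c. \<exists>d\<in>{1, -1}. \<forall>i.
    card {u \<in> verts G. pos u = i} = card {u \<in> verts H. pos' u = c + d * i}"
proof -
  interpret G: decorated_line G pos line by fact
  interpret H: decorated_line H pos' line' by fact
  obtain f where bij: "bij_betw f (verts G) (verts H)" and
    adj: "\<And>x y. x \<in> verts G \<Longrightarrow> y \<in> verts G \<Longrightarrow> (f x, f y) \<in> adj_rel H \<longleftrightarrow> (x, y) \<in> adj_rel G"
    using graph_iso_adj[OF assms(3) G.endpts_verts] by blast
  have inj: "inj_on f (verts G)" and im: "f ` verts G = verts H"
    using bij by (auto simp: bij_betw_def)
  define g where "g i = pos' (f (line i))" for i
  have on_line: "f u = line' (pos' (f u)) \<longleftrightarrow> u = line (pos u)" if "u \<in> verts G" for u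
  proof -
    have "f u \<in> verts H" using im that by blast
    then show ?thesis
      using cut_vertex_image[OF bij that adj] G.cut_vertex_imp_line[OF that] H.cut_vertex_imp_line
        G.cut_vertex_line H.cut_vertex_line by metis
  qed
  have f_line: "f (line i) = line' (g i)" for i
    using on_line[OF G.line_verts] G.pos_line unfolding g_def by metis
  have inj_g: "inj g"
  proof (rule injI)
    fix i j assume "g i = g j"
    then have "f (line i) = f (line j)" using f_line by simp
    then show "i = j" using inj_onD[OF inj _ G.line_verts G.line_verts] G.line_inj by blast
  qed
  have "\<bar>g (i + 1) - g i\<bar> = 1" for i
  proof -
    have "(line' (g i), line' (g (i + 1))) \<in> adj_rel H"
      using adj[OF G.line_verts G.line_verts] G.line_adj f_line by metis
    from H.adj_pos[OF this] show ?thesis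
      using injD[OF inj_g, of i "i + 1"] by (auto simp: H.pos_line)
  qed
  then obtain d where d: "d \<in> {1, -1}" "\<And>i. g i = g 0 + d * i"
    using injective_unit_steps_affine[OF inj_g] by blast
  have pos_f: "pos' (f u) = g (pos u)" if "u \<in> verts G" for u
    using G.connected_line[OF that]
  proof (induction rule: converse_rtrancl_induct)
    case base
    then show ?case by (simp add: g_def G.pos_line)
  next
    case (step u w)
    have uw: "u \<in> verts G" "w \<in> verts G" using G.adj_verts[OF step(1)] by auto
    show ?case
    proof (cases "u = line (pos u)")
      case True
      then show ?thesis using g_def by metis
    next
      case False
      then have "pos u = pos w" using G.adj_pos[OF step(1)] by blast
      moreover have "pos' (f u) = pos' (f w)"
        using False on_line[OF uw(1)] H.adj_pos adj[OF uw] step(1) by blast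
      ultimately show ?thesis using step(3) by simp
    qed
  qed
  have "card {u \<in> verts G. pos u = i} = card {u \<in> verts H. pos' u = g i}" for i
  proof -
    have "f ` {u \<in> verts G. pos u = i} = {u \<in> verts H. pos' u = g i}"
    proof (intro equalityI subsetI)
      fix x assume "x \<in> f ` {u \<in> verts G. pos u = i}"
      then show "x \<in> {u \<in> verts H. pos' u = g i}" using pos_f im by auto
    next
      fix x assume x: "x \<in> {u \<in> verts H. pos' u = g i}"
      then obtain u where u: "u \<in> verts G" "x = f u" using im by blast
      then have "g (pos u) = g i" using pos_f x by simp
      then have "pos u = i" using injD[OF inj_g] by blast
      then show "x \<in> f ` {u \<in> verts G. pos u = i}" using u by blast
    qed
    moreover have "inj_on f {u \<in> verts G. pos u = i}" using inj by (rule inj_on_subset) auto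
    ultimately show ?thesis by (metis card_image)
  qed
  then have "card {u \<in> verts G. pos u = i} = card {u \<in> verts H. pos' u = g 0 + d * i}" for i
    unfolding d(2)[symmetric] .
  then show ?thesis using d(1) by blast
qed

section \<open>The infinite orbits of a generator\<close>

lemma stream_eq_snthI: "(\<And>n. s !! n = t !! n) \<Longrightarrow> s = t"
  using smap_alt[of "\<lambda>x. x" s t] by (simp add: stream.map_ident)

text \<open>These are the words of infinite order under the generator. Since \<open>b(b(xw)) = x a(w)\<close> and \<open>a(0w) = 0 b(w)\<close>,
  \<open>a(1w) = 1w\<close>, the \<open>b\<close>-orbit of \<open>xw\<close> is infinite iff the \<open>a\<close>-orbit of \<open>w\<close> is, and the \<open>a\<close>-orbit of
  \<open>0w\<close> is infinite iff the \<open>b\<close>-orbit of \<open>w\<close> is. Unfolded, the words are those of the shape \<open>x0x0x0...\<close> for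
  \<open>b\<close> and \<open>0x0x0x...\<close> for \<open>a\<close>.\<close>

coinductive on_line :: "basilica_gen \<Rightarrow> bool stream \<Rightarrow> bool" where
  on_line_a: "on_line Gen_b w \<Longrightarrow> on_line Gen_a (False ## w)"
| on_line_b: "on_line Gen_a w \<Longrightarrow> on_line Gen_b (x ## w)"

lemma on_line_simps [simp]:
  "on_line Gen_a (x ## w) \<longleftrightarrow> \<not> x \<and> on_line Gen_b w"
  "on_line Gen_b (x ## w) \<longleftrightarrow> on_line Gen_a w"
  by (auto elim: on_line.cases intro: on_line.intros)

lemma on_line_gen_act_iff [simp]: "on_line s (gen_act s w) \<longleftrightarrow> on_line s w"
proof
  assume "on_line s (gen_act s w)"
  then show "on_line s w"
  proof (coinduction arbitrary: s w)
    case on_line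
    then show ?case
      by (cases s; cases w rule: stream.exhaust; cases "shd w") auto
  qed
next
  assume "on_line s w"
  then show "on_line s (gen_act s w)"
  proof (coinduction arbitrary: s w)
    case on_line
    then show ?case
      by (cases s; cases w rule: stream.exhaust; cases "shd w") auto
  qed
qed

text \<open>The nearest-point retraction onto the line of a generator. For \<open>b\<close>: the vertices \<open>0w\<close> and \<open>1w\<close> are joined
  by a \<open>b\<close>-edge, and the vertices \<open>0w\<close> carry a copy of the \<open>b\<close>-edges on the tails \<open>w\<close>, so what
  hangs at \<open>v\<close> among the tails hangs at \<open>0v\<close> one level up.
  For \<open>a\<close>: the line consists of the words \<open>0v\<close> with \<open>v\<close> on the line of \<open>b\<close>, and both \<open>0w\<close> and \<open>1w\<close> hang
  over the foot of \<open>w\<close>. On words without a line in their orbit the value has no meaning.\<close>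

primcorec proj :: "basilica_gen \<Rightarrow> bool stream \<Rightarrow> bool stream" where
  "proj s w = (case s of
      Gen_a \<Rightarrow> False ## proj Gen_b (stl w)
    | Gen_b \<Rightarrow> if on_line Gen_a (stl w) then shd w ## stl w else False ## proj Gen_a (stl w))"

lemma proj_a [simp]: "proj Gen_a (x ## w) = False ## proj Gen_b w"
  by (subst proj.code) simp

lemma proj_b: "proj Gen_b (x ## w) = (if on_line Gen_a w then x ## w else False ## proj Gen_a w)"
  by (subst proj.code) simp

lemma proj_on_line: "on_line s w \<Longrightarrow> proj s w = w"
proof (cases s)
  case Gen_b
  then show "on_line s w \<Longrightarrow> ?thesis" by (cases w) (simp add: proj_b)
next
  case Gen_a
  have *: "on_line Gen_b v \<Longrightarrow> proj Gen_b v = v" for v by (cases v) (simp add: proj_b)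
  from Gen_a show "on_line s w \<Longrightarrow> ?thesis" by (cases w) (simp add: *)
qed

lemma proj_b_False: "proj Gen_b (False ## w) = False ## proj Gen_a w"
  by (simp add: proj_b proj_on_line)

lemma proj_b_two: "proj Gen_b (x ## y ## w) =
    (if \<not> y \<and> on_line Gen_b w then x ## y ## w else False ## False ## proj Gen_b w)"
  by (simp add: proj_b)

text \<open>The only edges along which the retraction moves are the edges of the line. The retractions for
  \<open>a\<close> and \<open>b\<close> recur on tails through each other, so all four combinations of a line with a move
  are treated together, letter by letter.\<close>

lemma proj_gen_act:
  "proj s (gen_act t w) = (if s = t \<and> on_line s w then gen_act t w else proj s w)"
proof -
  have "snth (proj s (gen_act t w)) n =
      snth (if s = t \<and> on_line s w then gen_act t w else proj s w) n" for n
  proof (induction n arbitrary: s t w)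
    case 0
    show ?case
      by (cases s; cases t; cases w rule: stream.exhaust; cases "shd w") (auto simp: proj_b)
  next
    case (Suc n)
    obtain x v where w: "w = x ## v" by (cases w)
    show ?case
      using Suc.IH[of Gen_a Gen_a v] Suc.IH[of Gen_a Gen_b v] Suc.IH[of Gen_b Gen_a v]
        Suc.IH[of Gen_b Gen_b v]
      by (cases s; cases t; cases x) (auto simp: w proj_b proj_b_False proj_on_line split: if_splits)
  qed
  then show ?thesis by (rule stream_eq_snthI)
qed


text \<open>The integer powers of \<open>b\<close>, used as a parametrisation of its orbits.\<close>

definition turn :: "int \<Rightarrow> bool stream \<Rightarrow> bool stream" where
  "turn i w = (if 0 \<le> i then (gen_act Gen_b ^^ nat i) w else (gen_inv Gen_b ^^ nat (- i)) w)"

lemma turn_0 [simp]: "turn 0 w = w"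
  by (simp add: turn_def)

lemma turn_Suc: "turn (i + 1) w = gen_act Gen_b (turn i w)"
proof (cases "0 \<le> i")
  case True
  then have "nat (i + 1) = Suc (nat i)" by simp
  with True show ?thesis by (simp add: turn_def)
next
  case False
  then have "nat (- i) = Suc (nat (- (i + 1)))" by simp
  then have "turn i w = gen_inv Gen_b ((gen_inv Gen_b ^^ nat (- (i + 1))) w)"
    using False by (simp add: turn_def)
  moreover have "turn (i + 1) w = (gen_inv Gen_b ^^ nat (- (i + 1))) w"
    using False by (cases "i = -1") (auto simp: turn_def)
  ultimately show ?thesis by (simp add: gen_act_gen_inv)
qed

lemma turn_unique:
  assumes "\<And>i. l (i + 1) = gen_act Gen_b (l i)"
  shows "l i = turn i (l 0)"
proof (induction i rule: int_induct[where k = 0])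
  case (step1 i)
  then show ?case using assms turn_Suc by simp
next
  case (step2 i)
  have "gen_act Gen_b (l (i - 1)) = gen_act Gen_b (turn (i - 1) (l 0))"
    using step2 assms[of "i - 1"] turn_Suc[of "i - 1"] by simp
  then show ?case using gen_inv_gen_act by metis
qed simp

lemma turn_add: "turn (i + j) w = turn i (turn j w)"
  using turn_unique[of "\<lambda>i. turn (i + j) w" i] turn_Suc[of "_ + j" w] by (simp add: algebra_simps)

text \<open>On words of the form \<open>x0x0...\<close> the generator \<open>b\<close> is an odometer: its square acts on the remaining
  digits, and the first digit alternates.\<close>

lemma turn_double: "turn (2 * i) (x ## False ## w) = x ## False ## turn i w"
proof -
  have two: "turn (2 * (i + 1)) v = gen_act Gen_b (gen_act Gen_b (turn (2 * i) v))" for i v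
    using turn_Suc[of "2 * i" v] turn_Suc[of "2 * i + 1" v] by (simp add: algebra_simps)
  have square: "gen_act Gen_b (gen_act Gen_b (x ## False ## v)) = x ## False ## gen_act Gen_b v" for v
    by (cases x) auto
  show ?thesis
  proof (induction i rule: int_induct[where k = 0])
    case (step1 i)
    then show ?case unfolding two by (simp add: turn_Suc square)
  next
    case (step2 i)
    have "gen_act Gen_b (gen_act Gen_b (turn (2 * (i - 1)) (x ## False ## w))) =
        gen_act Gen_b (gen_act Gen_b (x ## False ## turn (i - 1) w))"
      using two[of "i - 1" "x ## False ## w"] step2(2) turn_Suc[of "i - 1" w] square by simp
    then show ?case using gen_inv_gen_act by metis
  qed simp
qed

lemma shd_turn: "shd (turn i w) = (shd w = even i)"
proof (induction i rule: int_induct[where k = 0])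
  case (step1 i)
  then show ?case by (simp add: turn_Suc)
next
  case (step2 i)
  then show ?case using turn_Suc[of "i - 1" w] by (auto split: if_splits)
qed simp

lemma on_line_turn [simp]: "on_line Gen_b (turn i w) \<longleftrightarrow> on_line Gen_b w"
proof (induction i rule: int_induct[where k = 0])
  case (step1 i)
  then show ?case by (simp add: turn_Suc)
next
  case (step2 i)
  then show ?case using turn_Suc[of "i - 1" w] by (metis diff_add_cancel on_line_gen_act_iff)
qed simp

text \<open>A period must be even because the first digit alternates, and half of it is a period of the
  tail; infinite descent.\<close>

lemma turn_free: "on_line Gen_b w \<Longrightarrow> turn i w = w \<Longrightarrow> i = 0"
proof (induction "nat \<bar>i\<bar>" arbitrary: i w rule: less_induct)
  case less
  obtain x y v where w: "w = x ## y ## v" by (metis stream.collapse)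
  then have v: "w = x ## False ## v" "on_line Gen_b v" using less.prems(1) by auto
  have "even i" using shd_turn[of i w] unfolding less.prems(2) by blast
  then obtain j where j: "i = 2 * j" by blast
  then have "turn j v = v" using less.prems(2) turn_double v by simp
  moreover have "nat \<bar>j\<bar> < nat \<bar>i\<bar>" if "i \<noteq> 0" using that j by linarith
  ultimately have "j = 0" if "i \<noteq> 0" using less.hyps[of j v] v(2) that by blast
  then show ?case using j by auto
qed

lemma turn_inj: "on_line Gen_b w \<Longrightarrow> turn i w = turn j w \<longleftrightarrow> i = j"
  using turn_free[of "turn j w" "i - j"] turn_add[of "i - j" j w] by auto

lemma step_turn: "(w, turn i w) \<in> step\<^sup>*"
proof (induction i rule: int_induct[where k = 0])
  case (step1 i)
  then show ?case using step_gen_act by (simp add: turn_Suc rtrancl_into_rtrancl)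
next
  case (step2 i)
  have "(turn i w, turn (i - 1) w) \<in> step"
    using turn_Suc[of "i - 1" w] symD[OF sym_step step_gen_act[of "turn (i - 1) w" Gen_b]] by simp
  with step2 show ?case by (simp add: rtrancl_into_rtrancl)
qed simp

section \<open>The decorations of the Basilica lines\<close>

definition fibre :: "bool stream \<Rightarrow> bool stream set" where
  "fibre v = {u. proj Gen_b u = v}"

text \<open>A vertex \<open>10w\<close> of the line is a fixed point of \<open>a\<close>: nothing hangs there.\<close>

lemma fibre_True: 
  assumes "on_line Gen_b (True ## False ## w)"
  shows "fibre (True ## False ## w) = {True ## False ## w}"
proof -
  have "u = True ## False ## w" if "proj Gen_b u = True ## False ## w" for u
  proof -
    obtain x y v where "u = x ## y ## v" by (metis stream.collapse)
    then show ?thesis using that by (auto simp: proj_b_two split: if_splits)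
  qed
  then show ?thesis using proj_on_line[OF assms] by (auto simp: fibre_def)
qed

text \<open>The recursion that governs the sizes of the decorations: the piece at \<open>00w\<close> is obtained from that at \<open>w\<close>
  by prefixing two arbitrary letters, except that \<open>10w\<close> is itself a vertex of the line.\<close>

lemma fibre_False:
  assumes "on_line Gen_b w"
  shows "fibre (False ## False ## w) =
    (\<lambda>(x, y, u). x ## y ## u) ` (UNIV \<times> UNIV \<times> fibre w) - {True ## False ## w}"
proof (rule Set.set_eqI)
  fix u :: "bool stream"
  obtain x y v where u: "u = x ## y ## v" by (metis stream.collapse)
  have "proj Gen_b u = False ## False ## w \<longleftrightarrow>
      proj Gen_b v = w \<and> \<not> (x \<and> \<not> y \<and> v = w)"
    using assms proj_on_line[OF assms] by (auto simp: u proj_b_two proj_on_line)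
  then show "u \<in> fibre (False ## False ## w) \<longleftrightarrow>
      u \<in> (\<lambda>(x, y, u). x ## y ## u) ` (UNIV \<times> UNIV \<times> fibre w) - {True ## False ## w}"
    by (auto simp: u fibre_def image_iff)
qed

lemma step_rtrancl_lift: "(u, v) \<in> step\<^sup>* \<Longrightarrow> (x ## y ## u, x' ## y' ## v) \<in> step\<^sup>*"
proof -
  assume "(u, v) \<in> step\<^sup>*"
  then have "(False ## False ## u, False ## False ## v) \<in> step\<^sup>*"
  proof induction
    case (step v w)
    then show ?case using near_imp_rtrancl[OF step_lift] by (metis rtrancl_trans)
  qed simp
  moreover have "(x ## y ## u, False ## False ## u) \<in> step\<^sup>*"
    "(False ## False ## v, x' ## y' ## v) \<in> step\<^sup>*"
    using near_imp_rtrancl near_two_letters near_sym by blast+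
  ultimately show ?thesis by (meson rtrancl_trans)
qed

text \<open>The recursion strips a pair \<open>00\<close> at each stage and ends at the first digit 1. The only word
  of the line at which it does not end is \<open>0^\<omega>\<close>, where an infinite piece is attached.\<close>

lemma fibre_finite_connected:
  assumes "on_line Gen_b v" "v !! n"
  shows "finite (fibre v) \<and> fibre v \<subseteq> step\<^sup>* `` {v}"
  using assms
proof (induction n arbitrary: v rule: less_induct)
  case (less n)
  obtain x y w where xy: "v = x ## y ## w" by (metis stream.collapse)
  then have v: "v = x ## False ## w" "on_line Gen_b w" using less.prems(1) by auto
  show ?case
  proof (cases x)
    case True
    then show ?thesis using fibre_True v less.prems(1) by simp
  next
    case False
    then obtain m where m: "n = Suc (Suc m)"
      using less.prems(2) v(1) by (metis not0_implies_Suc snth.simps snth_Stream stream.sel(1))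
    then have "finite (fibre w)" "fibre w \<subseteq> step\<^sup>* `` {w}"
      using less.IH[of m w] less.prems(2) v by auto
    then show ?thesis
      unfolding v(1) using False fibre_False[OF v(2)] step_rtrancl_lift by auto
  qed
qed

lemma on_line_in_fibre: "on_line Gen_b v \<Longrightarrow> v \<in> fibre v"
  by (simp add: fibre_def proj_on_line)

text \<open>The orbit of \<open>0^\<omega>\<close> is exceptional: there a second line is attached to the first one.\<close>

definition two_ended_words :: "bool stream set" where
  "two_ended_words = {\<xi>. on_line Gen_b \<xi> \<and> (sconst False, \<xi>) \<notin> step\<^sup>*}"

lemma step_class_not_zero:
  assumes "\<xi> \<in> two_ended_words" "(\<xi>, v) \<in> step\<^sup>*"
  shows "\<exists>n. v !! n"
proof (rule ccontr)
  assume "\<not> ?thesis"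
  then have "v = sconst False" by (intro stream_eq_snthI) simp
  then show False using assms step_rtrancl_sym unfolding two_ended_words_def by blast
qed

lemma turn_two_ended: "\<xi> \<in> two_ended_words \<Longrightarrow> turn i \<xi> \<in> two_ended_words"
  unfolding two_ended_words_def using step_rtrancl_sym[OF step_turn] by (auto intro: rtrancl_trans)

lemma two_ended_words_tail:
  assumes "x ## False ## w \<in> two_ended_words"
  shows "w \<in> two_ended_words"
proof -
  have "(sconst False, x ## False ## w) \<in> step\<^sup>*" if "(sconst False, w) \<in> step\<^sup>*"
  proof -
    have "sconst False = False ## sconst False" by (subst siterate.code) simp
    then have "False ## False ## sconst False = sconst False" by simp
    then show ?thesis using step_rtrancl_lift[OF that, of False False x False] by simp
  qed
  then show ?thesis using assms by (auto simp: two_ended_words_def)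
qed

lemma finite_fibre:
  assumes "\<xi> \<in> two_ended_words"
  shows "finite (fibre \<xi>)" "fibre \<xi> \<subseteq> step\<^sup>* `` {\<xi>}"
proof -
  obtain n where "\<xi> !! n" using step_class_not_zero[OF assms rtrancl.rtrancl_refl] by blast
  then show "finite (fibre \<xi>)" "fibre \<xi> \<subseteq> step\<^sup>* `` {\<xi>}"
    using fibre_finite_connected[of \<xi> n] assms by (auto simp: two_ended_words_def)
qed

definition line_pos :: "bool stream \<Rightarrow> bool stream \<Rightarrow> int" where
  "line_pos \<xi> u = (THE i. proj Gen_b u = turn i \<xi>)"

lemma line_pos_eq_iff:
  assumes "on_line Gen_b \<xi>" "(\<xi>, u) \<in> step\<^sup>*"
  shows "line_pos \<xi> u = i \<longleftrightarrow> proj Gen_b u = turn i \<xi>"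
proof -
  from assms(2) have "\<exists>i. proj Gen_b u = turn i \<xi>"
  proof induction
    case base
    show ?case by (rule exI[of _ 0]) (simp add: proj_on_line assms)
  next
    case (step u v)
    then obtain i where i: "proj Gen_b u = turn i \<xi>" by blast
    from step(2) obtain s where "v = gen_act s u \<or> u = gen_act s v" by (auto simp: step_def)
    then show ?case
    proof
      assume v: "v = gen_act s u"
      then show ?thesis
        using i turn_Suc[of i \<xi>] proj_gen_act[of Gen_b s u] proj_on_line[of Gen_b u] by metis
    next
      assume u: "u = gen_act s v"
      show ?thesis
      proof (cases "s = Gen_b \<and> on_line Gen_b v")
        case True
        then have "gen_act Gen_b (proj Gen_b v) = gen_act Gen_b (turn (i - 1) \<xi>)"
          using i u turn_Suc[of "i - 1" \<xi>] by (simp add: proj_on_line)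
        then show ?thesis using gen_inv_gen_act by metis
      next
        case False
        then show ?thesis using i u proj_gen_act[of Gen_b s v] by metis
      qed
    qed
  qed
  then obtain j where "proj Gen_b u = turn j \<xi>" by blast
  then show ?thesis unfolding line_pos_def using turn_inj[OF assms(1)] by auto
qed

lemma fibre_line_pos:
  assumes "\<xi> \<in> two_ended_words"
  shows "{u \<in> verts (schreier_graph \<xi>). line_pos \<xi> u = i} = fibre (turn i \<xi>)"
proof -
  have "on_line Gen_b \<xi>" using assms by (simp add: two_ended_words_def)
  moreover have "fibre (turn i \<xi>) \<subseteq> step\<^sup>* `` {\<xi>}"
    using finite_fibre(2)[OF turn_two_ended[OF assms, of i]] step_turn[of \<xi> i]
    by (auto intro: rtrancl_trans)
  ultimately show ?thesis
    unfolding verts_schreier using line_pos_eq_iff by (auto simp: fibre_def)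
qed

text \<open>The vertices \<open>turn i \<xi>\<close> form the line and the fibres of the retraction are the decorations,
  so everything proved about decorated lines applies.\<close>

lemma schreier_decorated_line:
  assumes "\<xi> \<in> two_ended_words"
  shows "decorated_line (schreier_graph \<xi>) (line_pos \<xi>) (\<lambda>i. turn i \<xi>)"
proof
  have on: "on_line Gen_b \<xi>" using assms by (simp add: two_ended_words_def)
  show "endpts (schreier_graph \<xi>) e \<subseteq> verts (schreier_graph \<xi>)" if "e \<in> edges (schreier_graph \<xi>)" for e
    using schreier_wf[OF that] .
  show "turn i \<xi> \<in> verts (schreier_graph \<xi>)" for i
    by (simp add: verts_schreier step_turn)
  show pos_turn: "line_pos \<xi> (turn i \<xi>) = i" for i
    using line_pos_eq_iff[OF on step_turn] on by (simp add: proj_on_line)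
  show "(turn i \<xi>, turn (i + 1) \<xi>) \<in> adj_rel (schreier_graph \<xi>)" for i
    using step_turn step_gen_act[of "turn i \<xi>" Gen_b] by (simp add: adj_schreier turn_Suc[symmetric])
  show "finite {u \<in> verts (schreier_graph \<xi>). line_pos \<xi> u = i}" for i
    unfolding fibre_line_pos[OF assms] using finite_fibre(1)[OF turn_two_ended[OF assms]] .
  show "(u, turn 0 \<xi>) \<in> (adj_rel (schreier_graph \<xi>))\<^sup>*" if "u \<in> verts (schreier_graph \<xi>)" for u
    using schreier_connected[OF that, of "turn 0 \<xi>"] by (simp add: verts_schreier)
  have act: "line_pos \<xi> (gen_act s u) = line_pos \<xi> u \<or>
      u = turn (line_pos \<xi> u) \<xi> \<and> gen_act s u = turn (line_pos \<xi> (gen_act s u)) \<xi> \<and>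
      line_pos \<xi> (gen_act s u) = line_pos \<xi> u + 1"
    if u: "(\<xi>, u) \<in> step\<^sup>*" for s u
  proof -
    have su: "(\<xi>, gen_act s u) \<in> step\<^sup>*" using u step_gen_act by (rule rtrancl_into_rtrancl)
    have proj_u: "proj Gen_b u = turn (line_pos \<xi> u) \<xi>"
      using line_pos_eq_iff[OF on u] by blast
    show ?thesis
    proof (cases "s = Gen_b \<and> on_line Gen_b u")
      case True
      then have "u = turn (line_pos \<xi> u) \<xi>" using proj_u proj_on_line by metis
      moreover from this have "gen_act s u = turn (line_pos \<xi> u + 1) \<xi>"
        using True turn_Suc by metis
      ultimately show ?thesis using pos_turn by metis
    next
      case False
      then have "proj Gen_b (gen_act s u) = turn (line_pos \<xi> u) \<xi>"
        using proj_u proj_gen_act[of Gen_b s u] by metis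
      then show ?thesis using line_pos_eq_iff[OF on su] by blast
    qed
  qed
  show "line_pos \<xi> u = line_pos \<xi> v \<or>
      u = turn (line_pos \<xi> u) \<xi> \<and> v = turn (line_pos \<xi> v) \<xi> \<and> \<bar>line_pos \<xi> u - line_pos \<xi> v\<bar> = 1"
    if "(u, v) \<in> adj_rel (schreier_graph \<xi>)" for u v
  proof -
    from that have uv: "(\<xi>, u) \<in> step\<^sup>*" "(\<xi>, v) \<in> step\<^sup>*" "(u, v) \<in> step"
      by (auto simp: adj_schreier)
    have unit: "a = b + 1 \<Longrightarrow> \<bar>b - a\<bar> = 1" "a = b + 1 \<Longrightarrow> \<bar>a - b\<bar> = 1" for a b :: int by auto
    from uv(3) obtain s where "v = gen_act s u \<or> u = gen_act s v" by (auto simp: step_def)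
    then show ?thesis
    proof
      assume "v = gen_act s u"
      then show ?thesis using act[OF uv(1), of s] unit by metis
    next
      assume "u = gen_act s v"
      then show ?thesis using act[OF uv(2), of s] unit by metis
    qed
  qed
qed

lemma two_ended_words_E2: "two_ended_words \<subseteq> E2"
  using decorated_line.two_ended[OF schreier_decorated_line] by (auto simp: E2_def)

section \<open>Uncountably many isomorphism classes\<close>

text \<open>In particular a nontrivial decoration never has size 1, and its size determines that of the
  decoration of the tail.\<close>

lemma card_fibre_False:
  assumes "w \<in> two_ended_words"
  shows "card (fibre (False ## False ## w)) + 1 = 4 * card (fibre w)"
proof -
  have on: "on_line Gen_b w" using assms by (simp add: two_ended_words_def)
  let ?F = "(\<lambda>(x, y, u). x ## y ## u) ` (UNIV \<times> UNIV \<times> fibre w) :: bool stream set"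
  have "finite ?F" using finite_fibre(1)[OF assms] by simp
  moreover have "True ## False ## w \<in> ?F" 
    using on_line_in_fibre[OF on] by (intro image_eqI[of _ _ "(True, False, w)"]) auto
  moreover have "card ?F = 4 * card (fibre w)"
    by (subst card_image) (auto simp: inj_on_def card_cartesian_product)
  ultimately show ?thesis unfolding fibre_False[OF on]
    using card_Suc_Diff1 by fastforce
qed

text \<open>The size at the origin is 1 exactly when the first digit is 1, so it reveals this digit. After moving by one
  \<open>b\<close>-step if that digit is 1, the even positions carry words \<open>00w\<close> and show the sizes along the line
  of the tail, from which the remaining digits are read off in the same way.\<close>

lemma fibre_cards_determine:
  assumes "\<xi> \<in> two_ended_words" "\<eta> \<in> two_ended_words"
    and "\<And>i. card (fibre (turn i \<xi>)) = card (fibre (turn i \<eta>))"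
  shows "\<xi> = \<eta>"
proof (rule stream_eq_snthI)
  fix n
  from assms show "\<xi> !! n = \<eta> !! n"
  proof (induction n arbitrary: \<xi> \<eta> rule: less_induct)
    case (less n)
    have split: "\<exists>x w. \<zeta> = x ## False ## w \<and> w \<in> two_ended_words \<and>
        (x \<longleftrightarrow> card (fibre \<zeta>) = 1) \<and> (\<forall>i. turn (2 * i + of_bool x) \<zeta> = False ## False ## turn i w)"
      if \<zeta>: "\<zeta> \<in> two_ended_words" for \<zeta>
    proof -
      obtain x y w where xy: "\<zeta> = x ## y ## w" by (metis stream.collapse)
      have on: "on_line Gen_b \<zeta>" using \<zeta> by (simp add: two_ended_words_def)
      then have z: "\<zeta> = x ## False ## w" using xy by simp
      then have w: "w \<in> two_ended_words" using two_ended_words_tail \<zeta> by blast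
      show ?thesis
      proof (cases x)
        case True
        then have "card (fibre \<zeta>) = 1" using fibre_True on z by simp
        moreover have "turn 1 \<zeta> = False ## False ## w" using turn_Suc[of 0 \<zeta>] z True by simp
        then have "turn (2 * i + 1) \<zeta> = False ## False ## turn i w" for i
          by (simp add: turn_add turn_double)
        ultimately show ?thesis using z w True by auto
      next
        case False
        have "card (fibre \<zeta>) \<noteq> 1"
        proof
          assume "card (fibre \<zeta>) = 1"
          then have "1 + 1 = 4 * card (fibre w)" using card_fibre_False[OF w] z False by simp
          then show False by presburger
        qed
        then show ?thesis using z w False turn_double by auto
      qed
    qed
    obtain x w where x: "\<xi> = x ## False ## w" "w \<in> two_ended_words" "x \<longleftrightarrow> card (fibre \<xi>) = 1"
        "\<And>i. turn (2 * i + of_bool x) \<xi> = False ## False ## turn i w"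
      using split[OF less.prems(1)] by blast
    obtain y v where y: "\<eta> = y ## False ## v" "v \<in> two_ended_words" "y \<longleftrightarrow> card (fibre \<eta>) = 1"
        "\<And>i. turn (2 * i + of_bool y) \<eta> = False ## False ## turn i v"
      using split[OF less.prems(2)] by blast
    have xy: "x = y" using x(3) y(3) less.prems(3)[of 0] by simp
    have cards: "card (fibre (turn i w)) = card (fibre (turn i v))" for i
      using less.prems(3)[of "2 * i + of_bool x"] x(4)[of i] y(4)[of i] xy
        card_fibre_False[OF turn_two_ended[OF x(2), of i]]
        card_fibre_False[OF turn_two_ended[OF y(2), of i]] by simp
    consider "n = 0" | "n = 1" | m where "n = Suc (Suc m)"
      by (metis One_nat_def not0_implies_Suc)
    then show ?case
    proof cases
      case (3 m)
      then show ?thesis using less.IH[of m w v] cards x(1,2) y(1,2) by simp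
    qed (use x(1) y(1) xy in auto)
  qed
qed

text \<open>For a fixed \<open>\<xi>\<close>, an isomorphic graph is determined by the coordinate change of the line, an affine map of
  the integers, because the sequence of fibre sizes determines the word. There are only
  countably many such maps.\<close>

lemma countable_iso_class:
  assumes \<xi>: "\<xi> \<in> two_ended_words"
  shows "countable {\<eta> \<in> two_ended_words. graph_iso (schreier_graph \<xi>) (schreier_graph \<eta>)}"
proof -
  let ?X = "{\<eta> \<in> two_ended_words. graph_iso (schreier_graph \<xi>) (schreier_graph \<eta>)}"
  let ?F = "\<lambda>\<zeta> i. card (fibre (turn i \<zeta>))"
  have "\<exists>c d. ?F \<eta> = (\<lambda>i. ?F \<xi> (d * (i - c)))" if "\<eta> \<in> ?X" for \<eta>
  proof -
    from that have \<eta>: "\<eta> \<in> two_ended_words" and iso: "graph_iso (schreier_graph \<xi>) (schreier_graph \<eta>)"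
      by auto
    obtain c d where d: "d \<in> {1, -1 :: int}" and F: "\<And>i. ?F \<xi> i = ?F \<eta> (c + d * i)"
      using iso_decorated_lines[OF schreier_decorated_line[OF \<xi>] schreier_decorated_line[OF \<eta>] iso]
      unfolding fibre_line_pos[OF \<xi>] fibre_line_pos[OF \<eta>] by blast
    have "?F \<eta> i = ?F \<xi> (d * (i - c))" for i
      using F[of "d * (i - c)"] d by auto
    then have "?F \<eta> = (\<lambda>i. ?F \<xi> (d * (i - c)))" by (rule ext)
    then show ?thesis by (intro exI)
  qed
  then have "?F ` ?X \<subseteq> range (\<lambda>(c, d) i. ?F \<xi> (d * (i - c)))"
    by (auto simp: image_iff)
  then have "countable (?F ` ?X)" by (rule countable_subset) simp
  moreover have "inj_on ?F ?X"
    using fibre_cards_determine by (auto intro!: inj_onI dest: fun_cong)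
  ultimately show ?thesis by (rule countable_image_inj_on)
qed

lemma countable_step_class: "countable (step\<^sup>* `` {u})"
proof -
  have "step\<^sup>* `` {u} \<subseteq> (\<Union>n. {v. near n u v})"
  proof
    fix v assume "v \<in> step\<^sup>* `` {u}"
    then obtain n where "(u, v) \<in> step ^^ n" using rtrancl_imp_relpow by fast
    then have "near n u v" by (auto simp: near_def)
    then show "v \<in> (\<Union>n. {v. near n u v})" by blast
  qed
  moreover have "countable {v. near n u v}" for n
    using near_ball_bound[of n] by (intro countable_finite) metis
  then have "countable (\<Union>n. {v. near n u v})" by simp
  ultimately show ?thesis by (rule countable_subset)
qed

lemma on_line_if_odd_zero: "(\<And>n. \<not> w !! (2 * n + 1)) \<Longrightarrow> on_line Gen_b w"
proof -
  have "(s = Gen_b \<and> (\<forall>n. \<not> w !! (2 * n + 1))) \<or> (s = Gen_a \<and> (\<forall>n. \<not> w !! (2 * n))) \<Longrightarrow> on_line s w"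
    for s
  proof (coinduction arbitrary: s w)
    case (on_line s w)
    obtain x v where w: "w = x ## v" by (cases w)
    from on_line show ?case
    proof
      assume "s = Gen_b \<and> (\<forall>n. \<not> w !! (2 * n + 1))"
      then show ?thesis by (simp add: w)
    next
      assume a: "s = Gen_a \<and> (\<forall>n. \<not> w !! (2 * n))"
      then have "\<not> x" using w by (metis mult_0_right snth.simps(1) stream.sel(1))
      moreover have "\<not> v !! (2 * n + 1)" for n
      proof -
        have "\<not> w !! (2 * Suc n)" using a by blast
        then show ?thesis by (simp add: w)
      qed
      ultimately show ?thesis using a w by simp
    qed
  qed
  then show "(\<And>n. \<not> w !! (2 * n + 1)) \<Longrightarrow> on_line Gen_b w" by blast
qed

lemma on_line_interleave: "on_line Gen_b (smap (\<lambda>n. even n \<and> f (n div 2)) nats)"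
  by (rule on_line_if_odd_zero) simp

lemma uncountable_on_line: "uncountable {w. on_line Gen_b w}"
proof
  let ?w = "\<lambda>f. smap (\<lambda>n. even n \<and> f (n div 2)) nats"
  assume "countable {w. on_line Gen_b w}"
  then obtain e :: "nat \<Rightarrow> bool stream" where e: "range e = {w. on_line Gen_b w}"
    using uncountable_def on_line_interleave by (metis (mono_tags, lifting) empty_iff mem_Collect_eq)
  \<comment> \<open>Diagonalise: the digit at position \<open>2n\<close> is free.\<close>
  define f where "f n = (\<not> e n !! (2 * n))" for n
  obtain k where k: "e k = ?w f" using e on_line_interleave[of f] by (metis (mono_tags) mem_Collect_eq rangeE)
  have "e k !! (2 * k) \<longleftrightarrow> f k" unfolding k by simp
  then show False by (simp add: f_def)
qed

lemma uncountable_two_ended_words: "uncountable two_ended_words"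
proof
  assume "countable two_ended_words"
  then have "countable (two_ended_words \<union> step\<^sup>* `` {sconst False})"
    using countable_step_class by blast
  then have "countable {w. on_line Gen_b w}"
    by (rule countable_subset[rotated]) (auto simp: two_ended_words_def)
  then show False using uncountable_on_line by blast
qed

lemma graph_iso_refl: "graph_iso G G"
  unfolding graph_iso_def by (intro exI[of _ id]) auto

theorem corollary5p0p8:
  shows "uncountable ((schreier_graph ` E2) // {(G, H). graph_iso G H}) \<and>
         (\<forall>\<xi>\<in>E2. \<not> quasi_isometric_graphs (schreier_graph \<xi>) int_lattice)"
proof
  let ?R = "{(G, H). graph_iso G H} :: (bool stream, bool stream \<times> basilica_gen) multigraph rel"
  let ?cls = "\<lambda>\<xi>. ?R `` {schreier_graph \<xi>}"
  show "uncountable ((schreier_graph ` E2) // ?R)"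
  proof
    assume "countable ((schreier_graph ` E2) // ?R)"
    moreover have "?cls ` two_ended_words \<subseteq> (schreier_graph ` E2) // ?R"
      using two_ended_words_E2 by (auto simp: quotient_def)
    ultimately have "countable (?cls ` two_ended_words)" using countable_subset by blast
    moreover have "countable {\<eta> \<in> two_ended_words. ?cls \<eta> = c}" if c: "c \<in> ?cls ` two_ended_words" for c
    proof -
      from c obtain \<xi> where \<xi>: "\<xi> \<in> two_ended_words" "c = ?cls \<xi>" by blast
      have "graph_iso (schreier_graph \<xi>) (schreier_graph \<eta>)" if "?cls \<eta> = c" for \<eta>
        using graph_iso_refl[of "schreier_graph \<eta>"] that \<xi>(2) by blast
      then have "{\<eta> \<in> two_ended_words. ?cls \<eta> = c} \<subseteq>
          {\<eta> \<in> two_ended_words. graph_iso (schreier_graph \<xi>) (schreier_graph \<eta>)}" by blast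
      then show ?thesis using countable_iso_class[OF \<xi>(1)] countable_subset by blast
    qed
    ultimately have "countable (\<Union>c\<in>?cls ` two_ended_words. {\<eta> \<in> two_ended_words. ?cls \<eta> = c})"
      by (rule countable_UN)
    then have "countable two_ended_words" by (rule countable_subset[rotated]) blast
    then show False using uncountable_two_ended_words by blast
  qed
qed (simp add: schreier_not_quasi_isometric_int)

end
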